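(* Let $\mathcal{C},\mathcal{D}$ be coherent categories, let $M:\mathcal{C}\to\mathcal{D}$ be a coherent functor and let $(\alpha_x:N(x)\hookrightarrow M(x))_{x\in\mathcal{C}}$ be a collection of subobjects in $\mathcal{D}$, indexed by the objects of $\mathcal{C}$. The following are equivalent: 1. $(\alpha_x)_{x\in\mathcal{C}}$ satisfies the Tarski-Vaught criterion and preserves finite products; 2. $(\alpha_x)_{x\in\mathcal{C}}$ extends (uniquely) to a coherent elementary subfunctor $\alpha:N\Rightarrow M$, i.e. there is a (unique) way to make $x\mapsto N(x)$ into a functor $N:\mathcal{C}\to\mathcal{D}$ such that $\alpha=(\alpha_x)_x$ is a natural transformation, and moreover $N$ is coherent and $\alpha$ is elementary.
   Context: A coherent category has finite limits, pullback-stable finite unions of subobjects, and pullback-stable (effective epi, mono) factorizations; a coherent functor preserves finite limits, finite unions and effective epimorphisms. Elementary: a natural transformation $\eta:N\Rightarrow M$ between coherent functors $\mathcal{C}\to\mathcal{D}$ is elementary if for each monomorphism $i:a\hookrightarrow x$ of $\mathcal{C}$ the naturality square with sides $Ni:Na\to Nx$, $\eta_x:Nx\to Mx$, $\eta_a:Na\to Ma$, $Mi:Ma\to Mx$ is a pullback. Tarski-Vaught criterion: for each monomorphism $i:\varphi\hookrightarrow x\times y$ of $\mathcal{C}$, identify $M(x\times y)$ with $M(x)\times M(y)$, and let $s=M(\varphi)\cap (M(x)\times N(y))$ and $q=M(\varphi)\cap(N(x)\times N(y))$ (subobjects of $M(x)\times M(y)$, formed by pullback). Let $f:s\twoheadrightarrow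 p$ be the effective epi part of the image factorization $s\twoheadrightarrow p\hookrightarrow N(y)$ of the composite $s\hookrightarrow M(x)\times N(y)\to N(y)$, and let $j:q\hookrightarrow s$ be the inclusion. The criterion demands that for every such $i$ the map $f\circ j:q\to p$ is an effective epimorphism. Preserving finite products: the collection $(\alpha_x)_x$ preserves finite products if $\alpha_1:N(1)\hookrightarrow M(1)=1_{\mathcal{D}}$ is an isomorphism and, for all objects $x,y$ of $\mathcal{C}$, there is an isomorphism $\varphi:N(x\times y)\to N(x)\times N(y)$ such that $(\alpha_x\times\alpha_y)\circ\varphi$ equals the composite of $\alpha_{x\times y}:N(x\times y)\hookrightarrow M(x\times y)$ with the canonical isomorphism $M(x\times y)\cong M(x)\times M(y)$. *)

theory Defs
  imports Main
begin

section \<open>Categories and functors\<close>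

text \<open>
  A category is given by sets of objects and of arrows inside ambient types; composition is
  written in the usual order (\<open>g \<cdot> f\<close> is ``\<open>f\<close>, then \<open>g\<close>'') and is
  meaningful only for composable arrows.
\<close>

record ('o, 'm) cat =
  Obj :: "'o set"
  Arr :: "'m set"
  Dom :: "'m \<Rightarrow> 'o"
  Cod :: "'m \<Rightarrow> 'o"
  Ident :: "'o \<Rightarrow> 'm"
  Comp :: "'m \<Rightarrow> 'm \<Rightarrow> 'm"  (infixr "\<cdot>\<index>" 70)

definition in_hom :: "('o, 'm) cat \<Rightarrow> 'm \<Rightarrow> 'o \<Rightarrow> 'o \<Rightarrow> bool" where
  "in_hom C f a b \<longleftrightarrow> f \<in> Arr C \<and> Dom C f = a \<and> Cod C f = b"

locale category =
  fixes C :: "('o, 'm) cat" (structure)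
  assumes Dom_Obj: "f \<in> Arr C \<Longrightarrow> Dom C f \<in> Obj C"
    and Cod_Obj: "f \<in> Arr C \<Longrightarrow> Cod C f \<in> Obj C"
    and Ident_in_hom: "x \<in> Obj C \<Longrightarrow> in_hom C (Ident C x) x x"
    and Comp_in_hom: "in_hom C f a b \<Longrightarrow> in_hom C g b c \<Longrightarrow> in_hom C (g \<cdot> f) a c"
    and Comp_Ident: "f \<in> Arr C \<Longrightarrow> f \<cdot> Ident C (Dom C f) = f"
    and Ident_Comp: "f \<in> Arr C \<Longrightarrow> Ident C (Cod C f) \<cdot> f = f"
    and Comp_assoc: "in_hom C f a b \<Longrightarrow> in_hom C g b c \<Longrightarrow> in_hom C h c d \<Longrightarrow>
                       (h \<cdot> g) \<cdot> f = h \<cdot> (g \<cdot> f)"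

record ('o, 'm, 'p, 'n) ftor =
  FObj :: "'o \<Rightarrow> 'p"
  FArr :: "'m \<Rightarrow> 'n"

locale is_functor = C: category C + D: category D
  for C :: "('o, 'm) cat" and D :: "('p, 'n) cat" and F :: "('o, 'm, 'p, 'n) ftor" +
  assumes FObj_Obj: "x \<in> Obj C \<Longrightarrow> FObj F x \<in> Obj D"
    and FArr_in_hom: "in_hom C f a b \<Longrightarrow> in_hom D (FArr F f) (FObj F a) (FObj F b)"
    and FArr_Ident: "x \<in> Obj C \<Longrightarrow> FArr F (Ident C x) = Ident D (FObj F x)"
    and FArr_Comp: "in_hom C f a b \<Longrightarrow> in_hom C g b c \<Longrightarrow>
                      FArr F (g \<cdot>\<^bsub>C\<^esub> f) = FArr F g \<cdot>\<^bsub>D\<^esub> FArr F f"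

definition ftor_comp ::
  "('p, 'n, 'q, 'k) ftor \<Rightarrow> ('o, 'm, 'p, 'n) ftor \<Rightarrow> ('o, 'm, 'q, 'k) ftor" where
  "ftor_comp G F = \<lparr>FObj = FObj G \<circ> FObj F, FArr = FArr G \<circ> FArr F\<rparr>"

definition nat_trans ::
  "('o, 'm) cat \<Rightarrow> ('p, 'n) cat \<Rightarrow> ('o, 'm, 'p, 'n) ftor \<Rightarrow> ('o, 'm, 'p, 'n) ftor \<Rightarrow>
    ('o \<Rightarrow> 'n) \<Rightarrow> bool" where
  "nat_trans C D F G \<eta> \<longleftrightarrow>
     (\<forall>x\<in>Obj C. in_hom D (\<eta> x) (FObj F x) (FObj G x)) \<and>
     (\<forall>f\<in>Arr C. \<eta> (Cod C f) \<cdot>\<^bsub>D\<^esub> FArr F f = FArr G f \<cdot>\<^bsub>D\<^esub> \<eta> (Dom C f))"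

definition mono_arr :: "('o, 'm) cat \<Rightarrow> 'm \<Rightarrow> bool" where
  "mono_arr C m \<longleftrightarrow> m \<in> Arr C \<and>
     (\<forall>t g h. in_hom C g t (Dom C m) \<and> in_hom C h t (Dom C m) \<and> m \<cdot>\<^bsub>C\<^esub> g = m \<cdot>\<^bsub>C\<^esub> h
        \<longrightarrow> g = h)"

definition iso_arr :: "('o, 'm) cat \<Rightarrow> 'm \<Rightarrow> bool" where
  "iso_arr C f \<longleftrightarrow> f \<in> Arr C \<and>
     (\<exists>g. in_hom C g (Cod C f) (Dom C f) \<and>
          g \<cdot>\<^bsub>C\<^esub> f = Ident C (Dom C f) \<and> f \<cdot>\<^bsub>C\<^esub> g = Ident C (Cod C f))"


section \<open>Limits\<close>

definition is_cone ::
  "('i, 'a) cat \<Rightarrow> ('o, 'm) cat \<Rightarrow> ('i, 'a, 'o, 'm) ftor \<Rightarrow> 'o \<Rightarrow> ('i \<Rightarrow> 'm) \<Rightarrow> bool" where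
  "is_cone J C F L \<pi> \<longleftrightarrow> L \<in> Obj C \<and>
     (\<forall>j\<in>Obj J. in_hom C (\<pi> j) L (FObj F j)) \<and>
     (\<forall>g\<in>Arr J. FArr F g \<cdot>\<^bsub>C\<^esub> \<pi> (Dom J g) = \<pi> (Cod J g))"

definition is_limit ::
  "('i, 'a) cat \<Rightarrow> ('o, 'm) cat \<Rightarrow> ('i, 'a, 'o, 'm) ftor \<Rightarrow> 'o \<Rightarrow> ('i \<Rightarrow> 'm) \<Rightarrow> bool" where
  "is_limit J C F L \<pi> \<longleftrightarrow> is_cone J C F L \<pi> \<and>
     (\<forall>T \<tau>. is_cone J C F T \<tau> \<longrightarrow>
        (\<exists>!h. in_hom C h T L \<and> (\<forall>j\<in>Obj J. \<pi> j \<cdot>\<^bsub>C\<^esub> h = \<tau> j)))"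

text \<open>
  Every finite category is isomorphic to one whose objects and arrows are natural numbers, so
  finite diagrams may be taken to be indexed by categories of type \<open>(nat, nat) cat\<close>.
\<close>

definition has_finite_limits :: "('o, 'm) cat \<Rightarrow> bool" where
  "has_finite_limits C \<longleftrightarrow>
     (\<forall>(J :: (nat, nat) cat) F. finite (Obj J) \<and> finite (Arr J) \<and> is_functor J C F
        \<longrightarrow> (\<exists>L \<pi>. is_limit J C F L \<pi>))"

definition preserves_finite_limits ::
  "('o, 'm) cat \<Rightarrow> ('p, 'n) cat \<Rightarrow> ('o, 'm, 'p, 'n) ftor \<Rightarrow> bool" where
  "preserves_finite_limits C D G \<longleftrightarrow>
     (\<forall>(J :: (nat, nat) cat) F L \<pi>. finite (Obj J) \<and> finite (Arr J) \<and> is_functor J C F \<and>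
        is_limit J C F L \<pi>
        \<longrightarrow> is_limit J D (ftor_comp G F) (FObj G L) (\<lambda>j. FArr G (\<pi> j)))"

definition is_terminal :: "('o, 'm) cat \<Rightarrow> 'o \<Rightarrow> bool" where
  "is_terminal C t \<longleftrightarrow> t \<in> Obj C \<and> (\<forall>x\<in>Obj C. \<exists>!h. in_hom C h x t)"

text \<open>The product object is the common domain of the two projections.\<close>

definition is_product :: "('o, 'm) cat \<Rightarrow> 'o \<Rightarrow> 'o \<Rightarrow> 'm \<Rightarrow> 'm \<Rightarrow> bool" where
  "is_product C x y p1 p2 \<longleftrightarrow>
     in_hom C p1 (Dom C p1) x \<and> in_hom C p2 (Dom C p1) y \<and>
     (\<forall>t h k. in_hom C h t x \<and> in_hom C k t y \<longrightarrow>
        (\<exists>!u. in_hom C u t (Dom C p1) \<and> p1 \<cdot>\<^bsub>C\<^esub> u = h \<and> p2 \<cdot>\<^bsub>C\<^esub> u = k))"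

text \<open>
  \<open>u\<close> is the arrow \<open>f \<times> g\<close> from the product with projections \<open>q1, q2\<close> to the one
  with projections \<open>p1, p2\<close>.
\<close>

definition is_product_arr ::
  "('o, 'm) cat \<Rightarrow> 'm \<Rightarrow> 'm \<Rightarrow> 'm \<Rightarrow> 'm \<Rightarrow> 'm \<Rightarrow> 'm \<Rightarrow> 'm \<Rightarrow> bool" where
  "is_product_arr C q1 q2 p1 p2 f g u \<longleftrightarrow>
     in_hom C u (Dom C q1) (Dom C p1) \<and>
     p1 \<cdot>\<^bsub>C\<^esub> u = f \<cdot>\<^bsub>C\<^esub> q1 \<and> p2 \<cdot>\<^bsub>C\<^esub> u = g \<cdot>\<^bsub>C\<^esub> q2"

text \<open>The pullback of the cospan \<open>f, g\<close> is the span \<open>p, q\<close> with \<open>f \<cdot> p = g \<cdot> q\<close>.\<close>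

definition is_pullback :: "('o, 'm) cat \<Rightarrow> 'm \<Rightarrow> 'm \<Rightarrow> 'm \<Rightarrow> 'm \<Rightarrow> bool" where
  "is_pullback C f g p q \<longleftrightarrow>
     f \<in> Arr C \<and> g \<in> Arr C \<and> Cod C f = Cod C g \<and>
     in_hom C p (Dom C p) (Dom C f) \<and> in_hom C q (Dom C p) (Dom C g) \<and>
     f \<cdot>\<^bsub>C\<^esub> p = g \<cdot>\<^bsub>C\<^esub> q \<and>
     (\<forall>t h k. in_hom C h t (Dom C f) \<and> in_hom C k t (Dom C g) \<and> f \<cdot>\<^bsub>C\<^esub> h = g \<cdot>\<^bsub>C\<^esub> k \<longrightarrow>
        (\<exists>!u. in_hom C u t (Dom C p) \<and> p \<cdot>\<^bsub>C\<^esub> u = h \<and> q \<cdot>\<^bsub>C\<^esub> u = k))"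


section \<open>Unions and images\<close>

text \<open>Subobjects are represented by monomorphisms, preordered by factorization.\<close>

definition sub_le :: "('o, 'm) cat \<Rightarrow> 'm \<Rightarrow> 'm \<Rightarrow> bool" where
  "sub_le C a b \<longleftrightarrow> (\<exists>h. in_hom C h (Dom C a) (Dom C b) \<and> b \<cdot>\<^bsub>C\<^esub> h = a)"

definition subobjects :: "('o, 'm) cat \<Rightarrow> 'o \<Rightarrow> 'm set" where
  "subobjects C x = {a. mono_arr C a \<and> Cod C a = x}"

definition is_union :: "('o, 'm) cat \<Rightarrow> 'o \<Rightarrow> 'm set \<Rightarrow> 'm \<Rightarrow> bool" where
  "is_union C x A u \<longleftrightarrow> A \<subseteq> subobjects C x \<and> u \<in> subobjects C x \<and>
     (\<forall>a\<in>A. sub_le C a u) \<and>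
     (\<forall>v\<in>subobjects C x. (\<forall>a\<in>A. sub_le C a v) \<longrightarrow> sub_le C u v)"

definition is_coequalizer :: "('o, 'm) cat \<Rightarrow> 'm \<Rightarrow> 'm \<Rightarrow> 'm \<Rightarrow> bool" where
  "is_coequalizer C p q e \<longleftrightarrow>
     p \<in> Arr C \<and> in_hom C q (Dom C p) (Cod C p) \<and> in_hom C e (Cod C p) (Cod C e) \<and>
     e \<cdot>\<^bsub>C\<^esub> p = e \<cdot>\<^bsub>C\<^esub> q \<and>
     (\<forall>t h. in_hom C h (Cod C p) t \<and> h \<cdot>\<^bsub>C\<^esub> p = h \<cdot>\<^bsub>C\<^esub> q \<longrightarrow>
        (\<exists>!u. in_hom C u (Cod C e) t \<and> u \<cdot>\<^bsub>C\<^esub> e = h))"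

definition effective_epi :: "('o, 'm) cat \<Rightarrow> 'm \<Rightarrow> bool" where
  "effective_epi C e \<longleftrightarrow> (\<exists>p q. is_pullback C e e p q \<and> is_coequalizer C p q e)"

definition is_image_factorization :: "('o, 'm) cat \<Rightarrow> 'm \<Rightarrow> 'm \<Rightarrow> 'm \<Rightarrow> bool" where
  "is_image_factorization C f e m \<longleftrightarrow>
     effective_epi C e \<and> mono_arr C m \<and> Cod C e = Dom C m \<and> m \<cdot>\<^bsub>C\<^esub> e = f"


section \<open>Coherent categories and coherent functors\<close>

text \<open>
  In the stability axiom for unions, \<open>b a\<close> is a pullback of the subobject \<open>a\<close> along
  \<open>f\<close>, and \<open>v\<close> one of the union. In the one for factorizations, the two pullback
  squares are pasted, so \<open>m' \<cdot> e'\<close> is the pullback of \<open>m \<cdot> e\<close> along \<open>g\<close>.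
\<close>

locale coherent_category = category C for C :: "('o, 'm) cat" (structure) +
  assumes finite_limits: "has_finite_limits C"
    and finite_unions:
      "x \<in> Obj C \<Longrightarrow> finite A \<Longrightarrow> A \<subseteq> subobjects C x \<Longrightarrow> \<exists>u. is_union C x A u"
    and finite_unions_stable:
      "finite A \<Longrightarrow> is_union C x A u \<Longrightarrow> in_hom C f y x \<Longrightarrow>
       (\<And>a. a \<in> A \<Longrightarrow> \<exists>k. is_pullback C f a (b a) k) \<Longrightarrow> is_pullback C f u v l \<Longrightarrow>
       is_union C y (b ` A) v"
    and factorizations:
      "f \<in> Arr C \<Longrightarrow> \<exists>e m. is_image_factorization C f e m"
    and factorizations_stable:
      "is_image_factorization C f e m \<Longrightarrow>
       is_pullback C g m m' g' \<Longrightarrow> is_pullback C g' e e' g'' \<Longrightarrow>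
       is_image_factorization C (m' \<cdot> e') e' m'"

locale coherent_functor = is_functor C D F
  for C :: "('o, 'm) cat" and D :: "('p, 'n) cat" and F :: "('o, 'm, 'p, 'n) ftor" +
  assumes pres_finite_limits: "preserves_finite_limits C D F"
    and pres_finite_unions:
      "finite A \<Longrightarrow> is_union C x A u \<Longrightarrow> is_union D (FObj F x) (FArr F ` A) (FArr F u)"
    and pres_effective_epi: "effective_epi C e \<Longrightarrow> effective_epi D (FArr F e)"

definition elementary ::
  "('o, 'm) cat \<Rightarrow> ('p, 'n) cat \<Rightarrow> ('o, 'm, 'p, 'n) ftor \<Rightarrow> ('o, 'm, 'p, 'n) ftor \<Rightarrow>
    ('o \<Rightarrow> 'n) \<Rightarrow> bool" where
  "elementary C D N M \<eta> \<longleftrightarrow>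
     (\<forall>i. mono_arr C i \<longrightarrow>
        is_pullback D (FArr M i) (\<eta> (Cod C i)) (\<eta> (Dom C i)) (FArr N i))"


section \<open>Collections of subobjects\<close>

text \<open>
  Below \<open>M\<close> is a coherent functor and \<open>\<alpha> x : N x \<rightarrow> M x\<close> are monomorphisms. Products,
  pullbacks and factorizations are determined up to isomorphism only, and we quantify over all
  choices of them. If \<open>p1, p2\<close> are product projections in \<open>C\<close>, then \<open>M(x \<times> y)\<close> with
  the projections \<open>M p1, M p2\<close> plays the role of \<open>M x \<times> M y\<close>.

  In the Tarski-Vaught criterion, \<open>u\<close> and \<open>v\<close> are the subobjects \<open>M x \<times> N y\<close>
  and \<open>N x \<times> N y\<close>; \<open>s\<close> and \<open>q\<close> are represented by the legs \<open>sm\<close> and \<open>qm\<close>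
  into \<open>M \<phi>\<close> of their pullbacks with \<open>M i\<close>; and \<open>r2 \<cdot> sn\<close> is the composite
  \<open>s \<rightarrow> M x \<times> N y \<rightarrow> N y\<close>.
\<close>

definition tarski_vaught ::
  "('o, 'm) cat \<Rightarrow> ('p, 'n) cat \<Rightarrow> ('o, 'm, 'p, 'n) ftor \<Rightarrow> ('o \<Rightarrow> 'p) \<Rightarrow> ('o \<Rightarrow> 'n) \<Rightarrow> bool"
  where
  "tarski_vaught C D M N \<alpha> \<longleftrightarrow>
     (\<forall>x\<in>Obj C. \<forall>y\<in>Obj C. \<forall>p1 p2 i. is_product C x y p1 p2 \<and> mono_arr C i \<and> Cod C i = Dom C p1 \<longrightarrow>
        (\<forall>r1 r2 u t1 t2 v sm sn qm qn j f k.
           is_product D (FObj M x) (N y) r1 r2 \<and>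
           is_product_arr D r1 r2 (FArr M p1) (FArr M p2) (Ident D (FObj M x)) (\<alpha> y) u \<and>
           is_product D (N x) (N y) t1 t2 \<and>
           is_product_arr D t1 t2 (FArr M p1) (FArr M p2) (\<alpha> x) (\<alpha> y) v \<and>
           is_pullback D (FArr M i) u sm sn \<and>
           is_pullback D (FArr M i) v qm qn \<and>
           in_hom D j (Dom D qm) (Dom D sm) \<and> sm \<cdot>\<^bsub>D\<^esub> j = qm \<and>
           is_image_factorization D (r2 \<cdot>\<^bsub>D\<^esub> sn) f k
           \<longrightarrow> effective_epi D (f \<cdot>\<^bsub>D\<^esub> j)))"

text \<open>
  \<open>a\<close> is \<open>\<alpha> x \<times> \<alpha> y : N x \<times> N y \<rightarrow> M x \<times> M y\<close> and \<open>c\<close> the canonical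
  comparison \<open>M(x \<times> y) \<rightarrow> M x \<times> M y\<close>.
\<close>

definition preserves_finite_products ::
  "('o, 'm) cat \<Rightarrow> ('p, 'n) cat \<Rightarrow> ('o, 'm, 'p, 'n) ftor \<Rightarrow> ('o \<Rightarrow> 'p) \<Rightarrow> ('o \<Rightarrow> 'n) \<Rightarrow> bool"
  where
  "preserves_finite_products C D M N \<alpha> \<longleftrightarrow>
     (\<forall>t. is_terminal C t \<longrightarrow> iso_arr D (\<alpha> t)) \<and>
     (\<forall>x\<in>Obj C. \<forall>y\<in>Obj C. \<forall>p1 p2. is_product C x y p1 p2 \<longrightarrow>
        (\<forall>t1 t2 s1 s2 a c.
           is_product D (N x) (N y) t1 t2 \<and>
           is_product D (FObj M x) (FObj M y) s1 s2 \<and>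
           is_product_arr D t1 t2 s1 s2 (\<alpha> x) (\<alpha> y) a \<and>
           in_hom D c (FObj M (Dom C p1)) (Dom D s1) \<and>
           s1 \<cdot>\<^bsub>D\<^esub> c = FArr M p1 \<and> s2 \<cdot>\<^bsub>D\<^esub> c = FArr M p2
           \<longrightarrow> (\<exists>\<phi>. iso_arr D \<phi> \<and> in_hom D \<phi> (N (Dom C p1)) (Dom D t1) \<and>
                    a \<cdot>\<^bsub>D\<^esub> \<phi> = c \<cdot>\<^bsub>D\<^esub> \<alpha> (Dom C p1))))"

text \<open>
  The action \<open>h\<close> on arrows makes \<open>x \<mapsto> N x\<close> a functor for which \<open>\<alpha>\<close> is natural.
\<close>

definition functorial_extension ::
  "('o, 'm) cat \<Rightarrow> ('p, 'n) cat \<Rightarrow> ('o, 'm, 'p, 'n) ftor \<Rightarrow> ('o \<Rightarrow> 'p) \<Rightarrow> ('o \<Rightarrow> 'n) \<Rightarrow>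
    ('m \<Rightarrow> 'n) \<Rightarrow> bool" where
  "functorial_extension C D M N \<alpha> h \<longleftrightarrow>
     is_functor C D \<lparr>FObj = N, FArr = h\<rparr> \<and> nat_trans C D \<lparr>FObj = N, FArr = h\<rparr> M \<alpha>"

definition extends_to_coherent_elementary ::
  "('o, 'm) cat \<Rightarrow> ('p, 'n) cat \<Rightarrow> ('o, 'm, 'p, 'n) ftor \<Rightarrow> ('o \<Rightarrow> 'p) \<Rightarrow> ('o \<Rightarrow> 'n) \<Rightarrow> bool"
  where
  "extends_to_coherent_elementary C D M N \<alpha> \<longleftrightarrow>
     (\<exists>h. functorial_extension C D M N \<alpha> h \<and>
          coherent_functor C D \<lparr>FObj = N, FArr = h\<rparr> \<and>
          elementary C D \<lparr>FObj = N, FArr = h\<rparr> M \<alpha>)"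

text \<open>
  Uniqueness is among all functor structures making \<open>\<alpha>\<close> natural, and means agreement on the
  arrows of \<open>C\<close>, since \<open>h\<close> is unconstrained elsewhere.
\<close>

definition uniquely_extends_to_coherent_elementary ::
  "('o, 'm) cat \<Rightarrow> ('p, 'n) cat \<Rightarrow> ('o, 'm, 'p, 'n) ftor \<Rightarrow> ('o \<Rightarrow> 'p) \<Rightarrow> ('o \<Rightarrow> 'n) \<Rightarrow> bool"
  where
  "uniquely_extends_to_coherent_elementary C D M N \<alpha> \<longleftrightarrow>
     (\<exists>h. functorial_extension C D M N \<alpha> h \<and>
          coherent_functor C D \<lparr>FObj = N, FArr = h\<rparr> \<and>
          elementary C D \<lparr>FObj = N, FArr = h\<rparr> M \<alpha> \<and>
          (\<forall>h'. functorial_extension C D M N \<alpha> h' \<longrightarrow> (\<forall>f\<in>Arr C. h' f = h f)))"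

end

theory Submission
  imports Defs
begin

text \<open>
  Read an arrow of \<open>C\<close> as a definable function, a subobject of \<open>x \<times> y\<close> as a formula
  \<open>\<phi>(x, y)\<close>, and the family \<open>\<alpha>\<close> as a subset of the model \<open>M\<close>, given sort by sort. The
  Tarski-Vaught criterion says that every \<open>y\<close> in \<open>N\<close> for which \<open>M\<close> has a witness of
  \<open>\<exists>x. \<phi>(x, y)\<close> has, locally on an effective cover, such a witness in \<open>N\<close>.

  Subobjects of products enter the proof as jointly monic spans \<open>x \<leftarrow> z \<rightarrow> y\<close>. In this form
  the subobject \<open>s\<close> is the pullback of \<open>M z \<rightarrow> M y\<close> along \<open>\<alpha> y\<close>, and \<open>q\<close> is the
  pullback of \<open>\<alpha> x\<close> to \<open>s\<close> (\<open>tarski_vaught_span\<close>). Three applications, each to the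
  graph of an arrow, give most of what the forward direction needs.

  \<^item> Eliminating the value of \<open>f : x \<rightarrow> y\<close>: the part of \<open>N x\<close> that \<open>M f\<close> maps into
    \<open>N y\<close> is both a subobject of \<open>N x\<close> and effectively epic over it, so it is all of
    \<open>N x\<close>. Hence \<open>M f\<close> restricts to \<open>N\<close> (\<open>restriction_exists\<close>). As \<open>\<alpha>\<close> is monic,
    restrictions are unique and therefore functorial.
  \<^item> Eliminating the argument of a monomorphism \<open>i : a \<rightarrow> x\<close>: here \<open>s\<close> is the intersection of
    \<open>M a\<close> and \<open>N x\<close>, and \<open>N a\<close> is effectively epic over it and a subobject of it. So
    the naturality square of \<open>i\<close> is a pullback (\<open>tarski_vaught_imp_elementary\<close>).
  \<^item> Eliminating the argument of an effective epimorphism \<open>e : x \<rightarrow> y\<close>: here \<open>s \<rightarrow> N y\<close>, a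
    pullback of \<open>M e\<close>, is an effective epimorphism, so its image is all of \<open>N y\<close>, and the
    criterion says exactly that \<open>N e\<close> is an effective epimorphism
    (\<open>tarski_vaught_imp_effective_epi\<close>).

  Once \<open>\<alpha>\<close> is elementary, \<open>N\<close> inherits unions from \<open>M\<close> because unions are stable under
  pullback along \<open>\<alpha> x\<close>. It inherits limits because the limit \<open>L\<close> of a finite diagram is a
  subobject of the product \<open>P\<close> of its vertices: \<open>N L\<close> is the intersection of \<open>M L\<close> with
  \<open>N P\<close>, and \<open>N P\<close> is known by preservation of products.

  Conversely, let \<open>N\<close> be a coherent elementary subfunctor, and let \<open>\<phi> \<rightarrow> \<psi> \<rightarrow> y\<close> be the
  image factorization, in \<open>C\<close>, of the second coordinate of \<open>\<phi>\<close>. Then \<open>q\<close> is \<open>N \<phi>\<close>, which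
  covers \<open>N \<psi>\<close>, and \<open>p\<close> is a subobject of \<open>N \<psi>\<close> through which this cover factors. So
  \<open>p\<close> is \<open>N \<psi>\<close>, and \<open>q\<close> covers it (\<open>coherent_elementary_imp_tarski_vaught\<close>).
\<close>

section \<open>Arrows, monomorphisms and pullbacks\<close>

context category
begin

lemma Arr_Comp [simp]: "f \<in> Arr C \<Longrightarrow> g \<in> Arr C \<Longrightarrow> Cod C f = Dom C g \<Longrightarrow> g \<cdot> f \<in> Arr C"
  and Dom_Comp [simp]: "f \<in> Arr C \<Longrightarrow> g \<in> Arr C \<Longrightarrow> Cod C f = Dom C g \<Longrightarrow> Dom C (g \<cdot> f) = Dom C f"
  and Cod_Comp [simp]: "f \<in> Arr C \<Longrightarrow> g \<in> Arr C \<Longrightarrow> Cod C f = Dom C g \<Longrightarrow> Cod C (g \<cdot> f) = Cod C g"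
  using Comp_in_hom[of f "Dom C f" "Cod C f" g "Cod C g"] by (auto simp: in_hom_def)

lemma Comp_Comp [simp]:
  "f \<in> Arr C \<Longrightarrow> g \<in> Arr C \<Longrightarrow> h \<in> Arr C \<Longrightarrow> Cod C f = Dom C g \<Longrightarrow> Cod C g = Dom C h \<Longrightarrow>
     (h \<cdot> g) \<cdot> f = h \<cdot> (g \<cdot> f)"
  using Comp_assoc[of f "Dom C f" "Cod C f" g "Cod C g" h "Cod C h"] by (auto simp: in_hom_def)

lemma Ident_simps [simp]:
  "x \<in> Obj C \<Longrightarrow> Ident C x \<in> Arr C"
  "x \<in> Obj C \<Longrightarrow> Dom C (Ident C x) = x"
  "x \<in> Obj C \<Longrightarrow> Cod C (Ident C x) = x"
  using Ident_in_hom[of x] by (auto simp: in_hom_def)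

lemma Comp_Ident' [simp]: "f \<in> Arr C \<Longrightarrow> Dom C f = x \<Longrightarrow> f \<cdot> Ident C x = f"
  and Ident_Comp' [simp]: "f \<in> Arr C \<Longrightarrow> Cod C f = x \<Longrightarrow> Ident C x \<cdot> f = f"
  using Comp_Ident Ident_Comp by auto

lemma in_hom_Obj: "in_hom C f a b \<Longrightarrow> a \<in> Obj C" "in_hom C f a b \<Longrightarrow> b \<in> Obj C"
  using Dom_Obj Cod_Obj by (auto simp: in_hom_def)

text \<open>
  Composites are normalized to the right, so an equation between binary composites must also be
  available in front of a further arrow.
\<close>

lemma extend_eq:
  "g \<cdot> f = r \<Longrightarrow> f \<in> Arr C \<Longrightarrow> g \<in> Arr C \<Longrightarrow> k \<in> Arr C \<Longrightarrow> Cod C f = Dom C g \<Longrightarrow>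
     Cod C k = Dom C f \<Longrightarrow> g \<cdot> (f \<cdot> k) = r \<cdot> k"
  using Comp_Comp[of k f g] by simp

lemma mono_arrD:
  assumes "mono_arr C m" "in_hom C g t (Dom C m)" "in_hom C h t (Dom C m)" "m \<cdot> g = m \<cdot> h"
  shows "g = h"
  using assms unfolding mono_arr_def by blast

lemma mono_arr_Arr: "mono_arr C m \<Longrightarrow> m \<in> Arr C"
  by (simp add: mono_arr_def)

lemma mono_arr_Comp:
  assumes "mono_arr C m" "mono_arr C n" "Cod C m = Dom C n"
  shows "mono_arr C (n \<cdot> m)"
  unfolding mono_arr_def
proof (intro conjI allI impI)
  have A: "m \<in> Arr C" "n \<in> Arr C" using assms mono_arr_Arr by auto
  then show "n \<cdot> m \<in> Arr C" using assms by simp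
  fix t g h
  assume "in_hom C g t (Dom C (n \<cdot> m)) \<and> in_hom C h t (Dom C (n \<cdot> m)) \<and> (n \<cdot> m) \<cdot> g = (n \<cdot> m) \<cdot> h"
  then have g: "in_hom C g t (Dom C m)" and h: "in_hom C h t (Dom C m)"
    and eq: "n \<cdot> (m \<cdot> g) = n \<cdot> (m \<cdot> h)"
    using A assms by (auto simp: in_hom_def)
  have "m \<cdot> g = m \<cdot> h"
    by (rule mono_arrD[OF assms(2) _ _ eq, of t]) (use g h A assms in \<open>auto simp: in_hom_def\<close>)
  then show "g = h" using mono_arrD[OF assms(1) g h] by simp
qed

lemma mono_arr_cancel:
  assumes "mono_arr C (n \<cdot> m)" "m \<in> Arr C" "n \<in> Arr C" "Cod C m = Dom C n"
  shows "mono_arr C m"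
  unfolding mono_arr_def
proof (intro conjI allI impI)
  show "m \<in> Arr C" by fact
  fix t g h
  assume *: "in_hom C g t (Dom C m) \<and> in_hom C h t (Dom C m) \<and> m \<cdot> g = m \<cdot> h"
  show "g = h"
    by (rule mono_arrD[OF assms(1), of g t h]) (use * assms in \<open>auto simp: in_hom_def\<close>)
qed

lemma mono_arr_Ident: "x \<in> Obj C \<Longrightarrow> mono_arr C (Ident C x)"
  unfolding mono_arr_def in_hom_def by (metis Ident_Comp' Ident_simps)

lemma pullbackI:
  assumes "in_hom C f a c" "in_hom C g b c" "in_hom C p d a" "in_hom C q d b" "f \<cdot> p = g \<cdot> q"
    and "\<And>t h k. in_hom C h t a \<Longrightarrow> in_hom C k t b \<Longrightarrow> f \<cdot> h = g \<cdot> k \<Longrightarrow>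
            \<exists>u. in_hom C u t d \<and> p \<cdot> u = h \<and> q \<cdot> u = k"
    and "\<And>t u u'. in_hom C u t d \<Longrightarrow> in_hom C u' t d \<Longrightarrow> p \<cdot> u = p \<cdot> u' \<Longrightarrow> q \<cdot> u = q \<cdot> u' \<Longrightarrow> u = u'"
  shows "is_pullback C f g p q"
proof -
  have e: "Dom C f = a" "Dom C g = b" "Dom C p = d" using assms by (auto simp: in_hom_def)
  have "\<exists>!u. in_hom C u t d \<and> p \<cdot> u = h \<and> q \<cdot> u = k"
    if "in_hom C h t a \<and> in_hom C k t b \<and> f \<cdot> h = g \<cdot> k" for t h k
    using assms(6)[of h t k] assms(7)[of _ t] that by metis
  then show ?thesis
    unfolding is_pullback_def e using assms(1-5) by (auto simp: in_hom_def)
qed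

lemma pullback_hom:
  assumes "is_pullback C f g p q"
  shows "in_hom C p (Dom C p) (Dom C f)" "in_hom C q (Dom C p) (Dom C g)" "f \<cdot> p = g \<cdot> q"
    "f \<in> Arr C" "g \<in> Arr C" "Cod C g = Cod C f"
  using assms by (auto simp: is_pullback_def)

lemma pullback_lift:
  assumes "is_pullback C f g p q" "in_hom C h t (Dom C f)" "in_hom C k t (Dom C g)" "f \<cdot> h = g \<cdot> k"
  obtains u where "in_hom C u t (Dom C p)" "p \<cdot> u = h" "q \<cdot> u = k"
  using assms unfolding is_pullback_def by blast

lemma pullback_ext:
  assumes P: "is_pullback C f g p q" and u: "in_hom C u t (Dom C p)" and u': "in_hom C u' t (Dom C p)"
    and "p \<cdot> u = p \<cdot> u'" "q \<cdot> u = q \<cdot> u'"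
  shows "u = u'"
proof -
  note H = pullback_hom[OF P]
  have "in_hom C (p \<cdot> u) t (Dom C f)" "in_hom C (q \<cdot> u) t (Dom C g)" "f \<cdot> (p \<cdot> u) = g \<cdot> (q \<cdot> u)"
    using H u extend_eq[OF H(3), of u] by (auto simp: in_hom_def)
  then have "\<exists>!w. in_hom C w t (Dom C p) \<and> p \<cdot> w = p \<cdot> u \<and> q \<cdot> w = q \<cdot> u"
    using P unfolding is_pullback_def by blast
  then show ?thesis using u u' assms(4,5) by metis
qed

lemma pullback_sym:
  assumes P: "is_pullback C f g p q"
  shows "is_pullback C g f q p"
proof -
  note H = pullback_hom[OF P]
  show ?thesis
  proof (rule pullbackI[where c = "Cod C f" and d = "Dom C p"])
    show "\<exists>u. in_hom C u t (Dom C p) \<and> q \<cdot> u = h \<and> p \<cdot> u = k"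
      if "in_hom C h t (Dom C g)" "in_hom C k t (Dom C f)" "g \<cdot> h = f \<cdot> k" for t h k
      using pullback_lift[OF P that(2,1)] that(3) by metis
    show "u = u'" if "in_hom C u t (Dom C p)" "in_hom C u' t (Dom C p)" "q \<cdot> u = q \<cdot> u'" "p \<cdot> u = p \<cdot> u'"
      for t u u' using pullback_ext[OF P that(1,2,4,3)] .
  qed (use H in \<open>auto simp: in_hom_def\<close>)
qed

lemma pullback_mono:
  assumes P: "is_pullback C f g p q" and g: "mono_arr C g"
  shows "mono_arr C p"
  unfolding mono_arr_def
proof (intro conjI allI impI)
  note H = pullback_hom[OF P]
  show "p \<in> Arr C" using H by (simp add: in_hom_def)
  fix t u u'
  assume A: "in_hom C u t (Dom C p) \<and> in_hom C u' t (Dom C p) \<and> p \<cdot> u = p \<cdot> u'"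
  have "g \<cdot> (q \<cdot> u) = g \<cdot> (q \<cdot> u')"
    using A H(1,2,4-6) extend_eq[OF H(3), of u] extend_eq[OF H(3), of u']
    by (auto simp: in_hom_def)
  then have "q \<cdot> u = q \<cdot> u'"
    by (rule mono_arrD[OF g, rotated 2, where t = t]) (use A H in \<open>auto simp: in_hom_def\<close>)
  then show "u = u'" using pullback_ext[OF P] A by blast
qed

lemma pullback_Ident:
  assumes g: "in_hom C g a x"
  shows "is_pullback C g (Ident C x) (Ident C a) g"
proof -
  have a: "a \<in> Obj C" and x: "x \<in> Obj C" using in_hom_Obj[OF g] by auto
  show ?thesis
  proof (rule pullbackI[OF g Ident_in_hom[OF x] Ident_in_hom[OF a] g])
    show "g \<cdot> Ident C a = Ident C x \<cdot> g" using g by (simp add: in_hom_def)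
    show "\<exists>u. in_hom C u t a \<and> Ident C a \<cdot> u = h \<and> g \<cdot> u = k"
      if "in_hom C h t a" "in_hom C k t x" "g \<cdot> h = Ident C x \<cdot> k" for t h k
      using that by (intro exI[of _ h]) (simp add: in_hom_def)
    show "u = u'" if "in_hom C u t a" "in_hom C u' t a" "Ident C a \<cdot> u = Ident C a \<cdot> u'" for t u u'
      using that by (simp add: in_hom_def)
  qed
qed

text \<open>
  Pulling back along the subobject \<open>m\<close> does not change an arrow \<open>b\<close> that already lands in
  it.
\<close>

lemma pullback_factor_mono:
  assumes m: "mono_arr C m" and j: "in_hom C j t (Dom C m)" and eq: "m \<cdot> j = b"
  shows "is_pullback C m b j (Ident C t)"
proof -
  have A: "m \<in> Arr C" "j \<in> Arr C" "Dom C j = t" "Cod C j = Dom C m" "t \<in> Obj C"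
    using mono_arr_Arr[OF m] j in_hom_Obj[OF j] by (auto simp: in_hom_def)
  have b: "b \<in> Arr C" "Dom C b = t" "Cod C b = Cod C m" using A by (auto simp flip: eq)
  show ?thesis
  proof (rule pullbackI[where a = "Dom C m" and c = "Cod C m" and b = t and d = t])
    show "\<exists>u. in_hom C u r t \<and> j \<cdot> u = h \<and> Ident C t \<cdot> u = k"
      if "in_hom C h r (Dom C m)" "in_hom C k r t" "m \<cdot> h = b \<cdot> k" for r h k
    proof -
      have "m \<cdot> (j \<cdot> k) = m \<cdot> h" using that A extend_eq[OF eq, of k] by (simp add: in_hom_def)
      then have "j \<cdot> k = h"
        by (rule mono_arrD[OF m, rotated 2, where t = r]) (use that A in \<open>simp_all add: in_hom_def\<close>)
      then show ?thesis using that by (intro exI[of _ k]) (simp add: in_hom_def)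
    qed
    show "u = u'" if "in_hom C u r t" "in_hom C u' r t" "Ident C t \<cdot> u = Ident C t \<cdot> u'" for r u u'
      using that by (simp add: in_hom_def)
  qed (use A b eq in \<open>simp_all add: in_hom_def\<close>)
qed

lemma pullback_iso:
  assumes P: "is_pullback C f g p q" and t: "iso_arr C t" "Cod C t = Dom C p"
  shows "is_pullback C f g (p \<cdot> t) (q \<cdot> t)"
proof -
  note H = pullback_hom[OF P]
  obtain s where s: "in_hom C s (Dom C p) (Dom C t)" "s \<cdot> t = Ident C (Dom C t)"
      "t \<cdot> s = Ident C (Dom C p)"
    using t unfolding iso_arr_def by auto
  have tA: "t \<in> Arr C" using t by (simp add: iso_arr_def)
  show ?thesis
  proof (rule pullbackI[where c = "Cod C f" and d = "Dom C t"])
    show "\<exists>u. in_hom C u r (Dom C t) \<and> (p \<cdot> t) \<cdot> u = h \<and> (q \<cdot> t) \<cdot> u = k"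
      if hk: "in_hom C h r (Dom C f)" "in_hom C k r (Dom C g)" "f \<cdot> h = g \<cdot> k" for r h k
    proof -
      obtain u where "in_hom C u r (Dom C p)" "p \<cdot> u = h" "q \<cdot> u = k"
        using pullback_lift[OF P hk] .
      then have "in_hom C (s \<cdot> u) r (Dom C t) \<and> (p \<cdot> t) \<cdot> (s \<cdot> u) = h \<and> (q \<cdot> t) \<cdot> (s \<cdot> u) = k"
        using H s(1) tA t(2) by (auto simp: in_hom_def extend_eq[OF s(3)])
      then show ?thesis by blast
    qed
    show "u = u'"
      if "in_hom C u r (Dom C t)" "in_hom C u' r (Dom C t)"
        "(p \<cdot> t) \<cdot> u = (p \<cdot> t) \<cdot> u'" "(q \<cdot> t) \<cdot> u = (q \<cdot> t) \<cdot> u'" for r u u'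
    proof -
      have "t \<cdot> u = t \<cdot> u'"
        by (rule pullback_ext[OF P, of _ r]) (use that H tA t(2) in \<open>auto simp: in_hom_def\<close>)
      then have "s \<cdot> (t \<cdot> u) = s \<cdot> (t \<cdot> u')" by simp
      then show ?thesis using that s(1) tA t(2) by (auto simp: in_hom_def extend_eq[OF s(2)])
    qed
  qed (use H tA t(2) extend_eq[OF H(3), of t] in \<open>auto simp: in_hom_def\<close>)
qed

section \<open>Effective epimorphisms and images\<close>

lemma effective_epiE:
  assumes "effective_epi C e"
  obtains p q where "e \<in> Arr C" "is_pullback C e e p q" "in_hom C p (Dom C p) (Dom C e)"
    "in_hom C q (Dom C p) (Dom C e)" "e \<cdot> p = e \<cdot> q"
    "\<And>t h. in_hom C h (Dom C e) t \<Longrightarrow> h \<cdot> p = h \<cdot> q \<Longrightarrow> \<exists>!u. in_hom C u (Cod C e) t \<and> u \<cdot> e = h"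
proof -
  obtain p q where P: "is_pullback C e e p q" and Q: "is_coequalizer C p q e"
    using assms unfolding effective_epi_def by blast
  note H = pullback_hom[OF P]
  have c: "Cod C p = Dom C e" using H by (simp add: in_hom_def)
  have "\<And>t h. in_hom C h (Dom C e) t \<Longrightarrow> h \<cdot> p = h \<cdot> q \<Longrightarrow> \<exists>!u. in_hom C u (Cod C e) t \<and> u \<cdot> e = h"
    using Q unfolding is_coequalizer_def c by blast
  then show ?thesis using that[of p q] P H by blast
qed

lemma effective_epi_Arr: "effective_epi C e \<Longrightarrow> e \<in> Arr C"
  unfolding effective_epi_def is_pullback_def by blast

lemma effective_epi_cancel:
  assumes e: "effective_epi C e" and "in_hom C u (Cod C e) t" "in_hom C u' (Cod C e) t" "u \<cdot> e = u' \<cdot> e"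
  shows "u = u'"
proof -
  obtain p q where pq: "e \<in> Arr C" "is_pullback C e e p q" "in_hom C p (Dom C p) (Dom C e)"
    "in_hom C q (Dom C p) (Dom C e)" "e \<cdot> p = e \<cdot> q"
    "\<And>t h. in_hom C h (Dom C e) t \<Longrightarrow> h \<cdot> p = h \<cdot> q \<Longrightarrow> \<exists>!u. in_hom C u (Cod C e) t \<and> u \<cdot> e = h"
    using effective_epiE[OF e] by blast
  have "in_hom C (u \<cdot> e) (Dom C e) t" "(u \<cdot> e) \<cdot> p = (u \<cdot> e) \<cdot> q"
    using assms(2) pq(1-5) by (auto simp: in_hom_def)
  from pq(6)[OF this] show ?thesis using assms(2-4) by metis
qed

text \<open>
  Effective epimorphisms are left orthogonal to monomorphisms: \<open>m\<close> can be cancelled from the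
  equation that makes \<open>k \<cdot> e\<close> coequalize the kernel pair of \<open>e\<close>, so \<open>g\<close> descends along
  \<open>e\<close>.
\<close>

lemma effective_epi_diagonal:
  assumes e: "effective_epi C e" and m: "mono_arr C m"
    and g: "in_hom C g (Dom C e) (Dom C m)" and k: "in_hom C k (Cod C e) (Cod C m)"
    and eq: "m \<cdot> g = k \<cdot> e"
  obtains d where "in_hom C d (Cod C e) (Dom C m)" "d \<cdot> e = g" "m \<cdot> d = k"
proof -
  obtain p q where pq: "e \<in> Arr C" "is_pullback C e e p q" "in_hom C p (Dom C p) (Dom C e)"
    "in_hom C q (Dom C p) (Dom C e)" "e \<cdot> p = e \<cdot> q"
    "\<And>t h. in_hom C h (Dom C e) t \<Longrightarrow> h \<cdot> p = h \<cdot> q \<Longrightarrow> \<exists>!u. in_hom C u (Cod C e) t \<and> u \<cdot> e = h"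
    using effective_epiE[OF e] by blast
  have mA: "m \<in> Arr C" using m by (rule mono_arr_Arr)
  have "m \<cdot> (g \<cdot> p) = m \<cdot> (g \<cdot> q)"
    using pq(1-5) mA g k by (auto simp: in_hom_def extend_eq[OF eq])
  then have "g \<cdot> p = g \<cdot> q"
    by (rule mono_arrD[OF m, rotated 2, where t = "Dom C p"]) (use pq(1-5) g in \<open>auto simp: in_hom_def\<close>)
  then obtain d where d: "in_hom C d (Cod C e) (Dom C m)" "d \<cdot> e = g"
    using pq(6)[OF g] by blast
  have "m \<cdot> d = k"
    by (rule effective_epi_cancel[OF e, of _ "Cod C m"]) (use d k mA eq pq(1) in \<open>auto simp: in_hom_def\<close>)
  then show ?thesis using that d by blast
qed

text \<open>The inverse is the diagonal of the square of \<open>e\<close> over itself with identity sides.\<close>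

lemma mono_effective_epi_iso:
  assumes e: "effective_epi C e" and m: "mono_arr C e"
  shows "iso_arr C e"
proof -
  have A: "e \<in> Arr C" using m by (rule mono_arr_Arr)
  obtain d where "in_hom C d (Cod C e) (Dom C e)" "d \<cdot> e = Ident C (Dom C e)" "e \<cdot> d = Ident C (Cod C e)"
    by (rule effective_epi_diagonal[OF e m, of "Ident C (Dom C e)" "Ident C (Cod C e)"])
      (use A Dom_Obj Cod_Obj in \<open>auto simp: in_hom_def\<close>)
  then show ?thesis using A unfolding iso_arr_def by blast
qed

lemma effective_epi_Ident:
  assumes x: "x \<in> Obj C"
  shows "effective_epi C (Ident C x)"
proof -
  have I: "in_hom C (Ident C x) x x" using x by (rule Ident_in_hom)
  have "is_coequalizer C (Ident C x) (Ident C x) (Ident C x)"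
    using x by (auto simp: is_coequalizer_def in_hom_def)
  then show ?thesis using pullback_Ident[OF I] unfolding effective_epi_def by blast
qed

lemma image_Ident_mono:
  "mono_arr C m \<Longrightarrow> is_image_factorization C m (Ident C (Dom C m)) m"
  by (simp add: is_image_factorization_def mono_arr_Arr Dom_Obj effective_epi_Ident)

lemma image_effective_epi_Ident:
  "effective_epi C e \<Longrightarrow> is_image_factorization C e e (Ident C (Cod C e))"
  by (simp add: is_image_factorization_def effective_epi_Arr Cod_Obj mono_arr_Ident)

text \<open>
  As \<open>d\<close> is monic, \<open>f\<close> has the same kernel pair as \<open>d \<cdot> f\<close>. Moreover \<open>d\<close> is invertible,
  because the diagonal of \<open>d \<cdot> f\<close> against \<open>d\<close> is a section of it. So \<open>f\<close> is a coequalizer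
  of that kernel pair as well.
\<close>

lemma effective_epi_of_mono_Comp:
  assumes de: "effective_epi C (d \<cdot> f)" and d: "mono_arr C d" and f: "f \<in> Arr C" "Cod C f = Dom C d"
  shows "effective_epi C f"
proof -
  have dA: "d \<in> Arr C" using d by (rule mono_arr_Arr)
  obtain p q where pq: "is_pullback C (d \<cdot> f) (d \<cdot> f) p q" "in_hom C p (Dom C p) (Dom C f)"
    "in_hom C q (Dom C p) (Dom C f)" "d \<cdot> (f \<cdot> p) = d \<cdot> (f \<cdot> q)"
    "\<And>t h. in_hom C h (Dom C f) t \<Longrightarrow> h \<cdot> p = h \<cdot> q \<Longrightarrow>
       \<exists>!u. in_hom C u (Cod C d) t \<and> u \<cdot> (d \<cdot> f) = h"
    by (rule effective_epiE[OF de]) (use dA f in \<open>auto simp: in_hom_def\<close>)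
  have fpq: "f \<cdot> p = f \<cdot> q"
    by (rule mono_arrD[OF d _ _ pq(4), of "Dom C p"]) (use pq(2,3) f in \<open>auto simp: in_hom_def\<close>)
  obtain c where c: "in_hom C c (Cod C d) (Dom C d)" "d \<cdot> c = Ident C (Cod C d)"
    by (rule effective_epi_diagonal[OF de d, of f "Ident C (Cod C d)"])
      (use f dA Cod_Obj[of d] in \<open>auto simp: in_hom_def\<close>)
  have cd: "c \<cdot> d = Ident C (Dom C d)"
    by (rule mono_arrD[OF d, of _ "Dom C d"])
      (use c dA Dom_Obj[of d] in \<open>auto simp: in_hom_def extend_eq[OF c(2)]\<close>)
  have "is_pullback C f f p q"
  proof (rule pullbackI[where d = "Dom C p" and c = "Cod C f"])
    show "\<exists>u. in_hom C u t (Dom C p) \<and> p \<cdot> u = h \<and> q \<cdot> u = k"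
      if hk: "in_hom C h t (Dom C f)" "in_hom C k t (Dom C f)" "f \<cdot> h = f \<cdot> k" for t h k
      by (rule pullback_lift[OF pq(1), of h t k])
        (use hk f dA in \<open>auto simp: in_hom_def\<close>)
    show "u = u'" if "in_hom C u t (Dom C p)" "in_hom C u' t (Dom C p)" "p \<cdot> u = p \<cdot> u'" "q \<cdot> u = q \<cdot> u'"
      for t u u' using pullback_ext[OF pq(1) that] .
  qed (use f fpq pq(2,3) in \<open>auto simp: in_hom_def\<close>)
  moreover have "is_coequalizer C p q f"
  proof -
    have "\<exists>!u. in_hom C u (Cod C f) t \<and> u \<cdot> f = h"
      if h: "in_hom C h (Dom C f) t" "h \<cdot> p = h \<cdot> q" for t h
    proof -
      obtain u where u: "in_hom C u (Cod C d) t" "u \<cdot> (d \<cdot> f) = h"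
        and uniq: "\<And>u'. in_hom C u' (Cod C d) t \<Longrightarrow> u' \<cdot> (d \<cdot> f) = h \<Longrightarrow> u' = u"
        using pq(5)[OF h] by metis
      show ?thesis
      proof (rule ex1I[of _ "u \<cdot> d"])
        show "in_hom C (u \<cdot> d) (Cod C f) t \<and> (u \<cdot> d) \<cdot> f = h"
          using u f dA by (auto simp: in_hom_def)
        fix v assume v: "in_hom C v (Cod C f) t \<and> v \<cdot> f = h"
        have "v \<cdot> c = u"
          by (rule uniq) (use v c f dA in \<open>auto simp: in_hom_def extend_eq[OF cd]\<close>)
        then have "u \<cdot> d = (v \<cdot> c) \<cdot> d" by simp
        then show "v = u \<cdot> d" using v c(1) f dA by (auto simp: in_hom_def cd)
      qed
    qed
    then show ?thesis
      using fpq pq(2,3) f by (auto simp: is_coequalizer_def in_hom_def)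
  qed
  ultimately show ?thesis unfolding effective_epi_def by blast
qed

section \<open>Binary products\<close>

lemma product_hom:
  assumes "is_product C x y p1 p2"
  shows "in_hom C p1 (Dom C p1) x" "in_hom C p2 (Dom C p1) y"
  using assms by (auto simp: is_product_def)

lemma product_lift:
  assumes "is_product C x y p1 p2" "in_hom C h t x" "in_hom C k t y"
  obtains u where "in_hom C u t (Dom C p1)" "p1 \<cdot> u = h" "p2 \<cdot> u = k"
  using assms unfolding is_product_def by blast

lemma product_ext:
  assumes P: "is_product C x y p1 p2" and u: "in_hom C u t (Dom C p1)" and u': "in_hom C u' t (Dom C p1)"
    and "p1 \<cdot> u = p1 \<cdot> u'" "p2 \<cdot> u = p2 \<cdot> u'"
  shows "u = u'"
proof -
  have "in_hom C (p1 \<cdot> u) t x" "in_hom C (p2 \<cdot> u) t y"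
    using product_hom[OF P] u by (auto simp: in_hom_def)
  then have "\<exists>!w. in_hom C w t (Dom C p1) \<and> p1 \<cdot> w = p1 \<cdot> u \<and> p2 \<cdot> w = p2 \<cdot> u"
    using P unfolding is_product_def by blast
  then show ?thesis using u u' assms(4,5) by metis
qed

lemma product_arr_mono:
  assumes Q: "is_product C x y q1 q2" and f: "mono_arr C f" "Dom C f = x" and g: "mono_arr C g" "Dom C g = y"
    and p: "p1 \<in> Arr C" "p2 \<in> Arr C" "Dom C p2 = Dom C p1"
    and v: "is_product_arr C q1 q2 p1 p2 f g v"
  shows "mono_arr C v"
  unfolding mono_arr_def
proof (intro conjI allI impI)
  have vA: "v \<in> Arr C" "Dom C v = Dom C q1" "Cod C v = Dom C p1"
    and eq: "p1 \<cdot> v = f \<cdot> q1" "p2 \<cdot> v = g \<cdot> q2"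
    using v by (auto simp: is_product_arr_def in_hom_def)
  show "v \<in> Arr C" by fact
  fix t r r'
  assume "in_hom C r t (Dom C v) \<and> in_hom C r' t (Dom C v) \<and> v \<cdot> r = v \<cdot> r'"
  then have r: "in_hom C r t (Dom C q1)" "in_hom C r' t (Dom C q1)" and vr: "v \<cdot> r = v \<cdot> r'"
    using vA by auto
  note A = p f g mono_arr_Arr[OF f(1)] mono_arr_Arr[OF g(1)] product_hom[OF Q, unfolded in_hom_def]
    r[unfolded in_hom_def] vA
  have fr: "f \<cdot> (q1 \<cdot> r) = f \<cdot> (q1 \<cdot> r')" and gr: "g \<cdot> (q2 \<cdot> r) = g \<cdot> (q2 \<cdot> r')"
    using A vr extend_eq[OF eq(1), of r] extend_eq[OF eq(1), of r'] extend_eq[OF eq(2), of r]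
      extend_eq[OF eq(2), of r'] by simp_all
  have "q1 \<cdot> r = q1 \<cdot> r'"
    by (rule mono_arrD[OF f(1) _ _ fr, of t]) (use A in \<open>simp_all add: in_hom_def\<close>)
  moreover have "q2 \<cdot> r = q2 \<cdot> r'"
    by (rule mono_arrD[OF g(1) _ _ gr, of t]) (use A in \<open>simp_all add: in_hom_def\<close>)
  ultimately show "r = r'" using product_ext[OF Q r] by blast
qed

end

text \<open>
  An effective epimorphism is its own image, with an identity as monic part, so stability of
  image factorizations contains stability of effective epimorphisms.
\<close>

lemma (in coherent_category) effective_epi_pullback:
  assumes e: "effective_epi C e" and P: "is_pullback C g e e' g'"
  shows "effective_epi C e'"
proof -
  note H = pullback_hom[OF P]
  have "is_pullback C g (Ident C (Cod C e)) (Ident C (Dom C g)) g"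
    by (rule pullback_Ident) (use H in \<open>auto simp: in_hom_def\<close>)
  from factorizations_stable[OF image_effective_epi_Ident[OF e] this P]
  show ?thesis by (simp add: is_image_factorization_def)
qed

text \<open>Precomposition with an isomorphism is a pullback along an identity.\<close>

lemma (in coherent_category) effective_epi_Comp_iso:
  assumes e: "effective_epi C e" and t: "iso_arr C t" "Cod C t = Dom C e"
  shows "effective_epi C (e \<cdot> t)"
proof -
  have A: "e \<in> Arr C" "Cod C e \<in> Obj C" using effective_epi_Arr[OF e] Cod_Obj by auto
  have "in_hom C e (Dom C e) (Cod C e)" using A by (simp add: in_hom_def)
  from pullback_iso[OF pullback_sym[OF pullback_Ident[OF this]]] t A
  have "is_pullback C (Ident C (Cod C e)) e (e \<cdot> t) (Ident C (Dom C e) \<cdot> t)"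
    by (simp add: in_hom_def)
  then show ?thesis using effective_epi_pullback[OF e] by blast
qed

section \<open>Terminal objects, binary products and pullbacks as finite limits\<close>

definition discrete_cat :: "'i set \<Rightarrow> ('i, 'i) cat" where
  "discrete_cat S = \<lparr>Obj = S, Arr = S, Dom = id, Cod = id, Ident = id, Comp = (\<lambda>g f. f)\<rparr>"

definition family_ftor :: "('o, 'm) cat \<Rightarrow> ('i \<Rightarrow> 'o) \<Rightarrow> ('i, 'i, 'o, 'm) ftor" where
  "family_ftor C X = \<lparr>FObj = X, FArr = (\<lambda>j. Ident C (X j))\<rparr>"

text \<open>
  The arrows \<open>0\<close>, \<open>1\<close>, \<open>2\<close> are the identities, \<open>3 : 0 \<rightarrow> 2\<close> and
  \<open>4 : 1 \<rightarrow> 2\<close> are the legs of the cospan. In a composable pair at least one arrow is an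
  identity, and the composite is the other one.
\<close>

definition cospan_cat :: "(nat, nat) cat" where
  "cospan_cat = \<lparr>Obj = {0, 1, 2}, Arr = {0, 1, 2, 3, 4},
     Dom = (\<lambda>f. if f = 3 then 0 else if f = 4 then 1 else f),
     Cod = (\<lambda>f. if f = 3 \<or> f = 4 then 2 else f),
     Ident = (\<lambda>x. x), Comp = (\<lambda>g f. if g = 3 \<or> g = 4 then g else f)\<rparr>"

definition cospan_ftor :: "('o, 'm) cat \<Rightarrow> 'm \<Rightarrow> 'm \<Rightarrow> (nat, nat, 'o, 'm) ftor" where
  "cospan_ftor C f g =
     (let X = (\<lambda>j. if j = 0 then Dom C f else if j = 1 then Dom C g else Cod C f)
      in \<lparr>FObj = X, FArr = (\<lambda>j. if j = 3 then f else if j = 4 then g else Ident C (X j))\<rparr>)"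

context category
begin

lemma family_ftor_functor:
  assumes "\<And>j. j \<in> S \<Longrightarrow> X j \<in> Obj C"
  shows "is_functor (discrete_cat S) C (family_ftor C X)"
  by unfold_locales (use assms in \<open>auto simp: discrete_cat_def family_ftor_def in_hom_def\<close>)

lemma cospan_ftor_functor:
  assumes f: "in_hom C f a c" and g: "in_hom C g b c"
  shows "is_functor cospan_cat C (cospan_ftor C f g)"
proof -
  have "a \<in> Obj C" "b \<in> Obj C" "c \<in> Obj C" "f \<in> Arr C" "g \<in> Arr C"
    "Dom C f = a" "Cod C f = c" "Dom C g = b" "Cod C g = c"
    using f g in_hom_Obj[OF f] in_hom_Obj[OF g] by (auto simp: in_hom_def)
  then show ?thesis
    by unfold_locales
      (auto simp: cospan_cat_def cospan_ftor_def in_hom_def Let_def split: if_splits)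
qed

lemma limit_empty_iff_terminal:
  "is_limit (discrete_cat {}) C F L \<pi> \<longleftrightarrow> is_terminal C L"
  by (auto simp: is_limit_def is_cone_def is_terminal_def discrete_cat_def)

lemma limit_pair_iff_product:
  assumes "FArr F 0 = Ident C (FObj F 0)" "FArr F 1 = Ident C (FObj F 1)"
  shows "is_limit (discrete_cat {0, 1 :: nat}) C F L \<pi> \<longleftrightarrow>
           Dom C (\<pi> 0) = L \<and> is_product C (FObj F 0) (FObj F 1) (\<pi> 0) (\<pi> 1)"
proof -
  let ?J = "discrete_cat {0, 1 :: nat}"
  have cone: "is_cone ?J C F T \<tau> \<longleftrightarrow> in_hom C (\<tau> 0) T (FObj F 0) \<and> in_hom C (\<tau> 1) T (FObj F 1)" for T \<tau>
  proof
    assume "in_hom C (\<tau> 0) T (FObj F 0) \<and> in_hom C (\<tau> 1) T (FObj F 1)"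
    moreover from this have "T \<in> Obj C" using in_hom_Obj by blast
    ultimately show "is_cone ?J C F T \<tau>"
      using assms by (auto simp: is_cone_def discrete_cat_def in_hom_def)
  qed (auto simp: is_cone_def discrete_cat_def)
  have obj: "Obj ?J = {0, 1}" by (simp add: discrete_cat_def)
  show ?thesis
  proof
    assume L: "is_limit ?J C F L \<pi>"
    then have p: "in_hom C (\<pi> 0) L (FObj F 0)" "in_hom C (\<pi> 1) L (FObj F 1)"
      unfolding is_limit_def cone by auto
    have "\<exists>!u. in_hom C u t L \<and> \<pi> 0 \<cdot> u = h \<and> \<pi> 1 \<cdot> u = k"
      if "in_hom C h t (FObj F 0)" "in_hom C k t (FObj F 1)" for t h k
    proof -
      have "is_cone ?J C F t (\<lambda>j. if j = 0 then h else k)" unfolding cone using that by simp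
      then have "\<exists>!u. in_hom C u t L \<and> (\<forall>j\<in>{0, 1}. \<pi> j \<cdot> u = (if j = 0 then h else k))"
        using L unfolding is_limit_def obj by blast
      then show ?thesis by simp
    qed
    then show "Dom C (\<pi> 0) = L \<and> is_product C (FObj F 0) (FObj F 1) (\<pi> 0) (\<pi> 1)"
      using p by (auto simp: is_product_def in_hom_def)
  next
    assume "Dom C (\<pi> 0) = L \<and> is_product C (FObj F 0) (FObj F 1) (\<pi> 0) (\<pi> 1)"
    then show "is_limit ?J C F L \<pi>"
      unfolding is_limit_def cone obj is_product_def by (elim conjE) simp
  qed
qed

lemma limit_cospan_pullback:
  assumes f: "in_hom C f a c" and g: "in_hom C g b c"
    and L: "is_limit cospan_cat C (cospan_ftor C f g) L \<pi>"
  shows "is_pullback C f g (\<pi> 0) (\<pi> 1)"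
proof -
  let ?F = "cospan_ftor C f g"
  have A: "f \<in> Arr C" "Dom C f = a" "Cod C f = c" "g \<in> Arr C" "Dom C g = b" "Cod C g = c"
    using f g by (auto simp: in_hom_def)
  have O: "a \<in> Obj C" "b \<in> Obj C" "c \<in> Obj C" using in_hom_Obj[OF f] in_hom_Obj[OF g] by auto
  have cone: "is_cone cospan_cat C ?F T \<tau> \<longleftrightarrow> in_hom C (\<tau> 0) T a \<and> in_hom C (\<tau> 1) T b \<and>
      in_hom C (\<tau> 2) T c \<and> f \<cdot> \<tau> 0 = \<tau> 2 \<and> g \<cdot> \<tau> 1 = \<tau> 2" for T \<tau>
    using A O Dom_Obj by (auto simp: is_cone_def cospan_cat_def cospan_ftor_def in_hom_def Let_def)
  have obj: "Obj cospan_cat = {0, 1, 2}" by (simp add: cospan_cat_def)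
  have p: "in_hom C (\<pi> 0) L a" "in_hom C (\<pi> 1) L b" "f \<cdot> \<pi> 0 = \<pi> 2" "g \<cdot> \<pi> 1 = \<pi> 2"
    using L unfolding is_limit_def cone by auto
  have U: "\<exists>!u. in_hom C u t L \<and> \<pi> 0 \<cdot> u = h \<and> \<pi> 1 \<cdot> u = k"
    if "in_hom C h t a" "in_hom C k t b" "f \<cdot> h = g \<cdot> k" for t h k
  proof -
    let ?\<tau> = "\<lambda>j::nat. if j = 0 then h else if j = 1 then k else f \<cdot> h"
    have "is_cone cospan_cat C ?F t ?\<tau>"
      unfolding cone using that A by (simp add: in_hom_def)
    then have "\<exists>!u. in_hom C u t L \<and> (\<forall>j\<in>{0, 1, 2}. \<pi> j \<cdot> u = ?\<tau> j)"
      using L unfolding is_limit_def obj by blast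
    moreover have "\<pi> 2 \<cdot> u = f \<cdot> h" if "in_hom C u t L" "\<pi> 0 \<cdot> u = h" for u
      using that A p extend_eq[OF p(3), of u] by (simp add: in_hom_def)
    then have "(in_hom C u t L \<and> (\<forall>j\<in>{0, 1, 2}. \<pi> j \<cdot> u = ?\<tau> j)) \<longleftrightarrow>
        (in_hom C u t L \<and> \<pi> 0 \<cdot> u = h \<and> \<pi> 1 \<cdot> u = k)" for u
      by auto
    ultimately show ?thesis by simp
  qed
  show ?thesis
    using A p U unfolding is_pullback_def by (simp add: in_hom_def)
qed

end

context coherent_category
begin

lemma limit_exists:
  fixes J :: "(nat, nat) cat"
  assumes "finite (Obj J)" "finite (Arr J)" "is_functor J C F"
  obtains L \<pi> where "is_limit J C F L \<pi>"
  using finite_limits assms unfolding has_finite_limits_def by blast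

lemma terminal_exists: obtains t where "is_terminal C t"
proof -
  have "is_functor (discrete_cat {}) C (family_ftor C X)" for X :: "nat \<Rightarrow> 'o"
    by (rule family_ftor_functor) simp
  from limit_exists[OF _ _ this] show ?thesis
    using that by (auto simp: limit_empty_iff_terminal) (auto simp: discrete_cat_def)
qed

lemma product_exists:
  assumes "x \<in> Obj C" "y \<in> Obj C"
  obtains p1 p2 where "is_product C x y p1 p2"
proof -
  let ?F = "family_ftor C (\<lambda>j::nat. if j = 0 then x else y)"
  have "is_functor (discrete_cat {0, 1}) C ?F"
    by (rule family_ftor_functor) (use assms in auto)
  then obtain L \<pi> where "is_limit (discrete_cat {0, 1}) C ?F L \<pi>"
    by (rule limit_exists[rotated 2]) (auto simp: discrete_cat_def)
  then have "is_product C (FObj ?F 0) (FObj ?F 1) (\<pi> 0) (\<pi> 1)"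
    by (subst (asm) limit_pair_iff_product) (auto simp: family_ftor_def)
  then show ?thesis using that by (simp add: family_ftor_def)
qed

lemma pullback_exists:
  assumes f: "in_hom C f a c" and g: "in_hom C g b c"
  obtains p q where "is_pullback C f g p q"
proof -
  obtain L \<pi> where "is_limit cospan_cat C (cospan_ftor C f g) L \<pi>"
    by (rule limit_exists[OF _ _ cospan_ftor_functor[OF f g]]) (auto simp: cospan_cat_def)
  from that[OF limit_cospan_pullback[OF f g this]] show ?thesis .
qed

end

context is_functor
begin

lemma preserves_terminal:
  assumes F: "preserves_finite_limits C D F" and t: "is_terminal C t"
  shows "is_terminal D (FObj F t)"
proof -
  let ?J = "discrete_cat {} :: (nat, nat) cat"
  have J: "is_functor ?J C (family_ftor C X)" for X
    by (rule C.family_ftor_functor) simp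
  have "is_limit ?J C (family_ftor C X) t \<pi>" for X \<pi>
    using t by (simp add: C.limit_empty_iff_terminal)
  moreover have "finite (Obj ?J)" "finite (Arr ?J)" by (auto simp: discrete_cat_def)
  ultimately have "is_limit ?J D (ftor_comp F (family_ftor C X)) (FObj F t) (\<lambda>j. FArr F (\<pi> j))" for X \<pi>
    using F J unfolding preserves_finite_limits_def by blast
  then show ?thesis by (simp add: D.limit_empty_iff_terminal)
qed

lemma preserves_product:
  assumes F: "preserves_finite_limits C D F" and P: "is_product C x y p1 p2"
  shows "is_product D (FObj F x) (FObj F y) (FArr F p1) (FArr F p2)"
proof -
  let ?J = "discrete_cat {0, 1} :: (nat, nat) cat"
  let ?X = "\<lambda>j::nat. if j = 0 then x else y"
  let ?\<pi> = "\<lambda>j::nat. if j = 0 then p1 else p2"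
  have xy: "x \<in> Obj C" "y \<in> Obj C" using C.product_hom[OF P] C.in_hom_Obj by blast+
  have J: "is_functor ?J C (family_ftor C ?X)"
    by (rule C.family_ftor_functor) (use xy in auto)
  have "is_limit ?J C (family_ftor C ?X) (Dom C p1) ?\<pi>"
    by (subst C.limit_pair_iff_product) (use P in \<open>auto simp: family_ftor_def\<close>)
  moreover have "finite (Obj ?J)" "finite (Arr ?J)" by (auto simp: discrete_cat_def)
  ultimately have "is_limit ?J D (ftor_comp F (family_ftor C ?X)) (FObj F (Dom C p1)) (\<lambda>j. FArr F (?\<pi> j))"
    using F J unfolding preserves_finite_limits_def by blast
  then have "is_product D (FObj (ftor_comp F (family_ftor C ?X)) 0) (FObj (ftor_comp F (family_ftor C ?X)) 1)
      (FArr F (?\<pi> 0)) (FArr F (?\<pi> 1))"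
    by (subst (asm) D.limit_pair_iff_product)
      (use xy FArr_Ident in \<open>auto simp: family_ftor_def ftor_comp_def\<close>)
  then show ?thesis by (simp add: family_ftor_def ftor_comp_def)
qed

lemma FArr_simps [simp]:
  assumes "f \<in> Arr C"
  shows "FArr F f \<in> Arr D" "Dom D (FArr F f) = FObj F (Dom C f)" "Cod D (FArr F f) = FObj F (Cod C f)"
  using FArr_in_hom[of f "Dom C f" "Cod C f"] assms by (auto simp: in_hom_def)

lemma FArr_Comp' [simp]:
  "f \<in> Arr C \<Longrightarrow> g \<in> Arr C \<Longrightarrow> Cod C f = Dom C g \<Longrightarrow>
     FArr F (g \<cdot>\<^bsub>C\<^esub> f) = FArr F g \<cdot>\<^bsub>D\<^esub> FArr F f"
  using FArr_Comp[of f "Dom C f" "Cod C f" g "Cod C g"] by (simp add: in_hom_def)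

end

text \<open>
  A monomorphism is the union of the family that consists of itself alone, and the union of the
  image family, being a subobject, is again monic.
\<close>

lemma (in coherent_functor) preserves_mono:
  assumes m: "mono_arr C m"
  shows "mono_arr D (FArr F m)"
proof -
  have A: "m \<in> Arr C" using m by (rule C.mono_arr_Arr)
  have "sub_le C m m"
    unfolding sub_le_def
    by (rule exI[of _ "Ident C (Dom C m)"]) (use A C.Dom_Obj in \<open>auto simp: in_hom_def\<close>)
  then have "is_union C (Cod C m) {m} m"
    using m by (auto simp: is_union_def subobjects_def)
  from pres_finite_unions[OF _ this] show ?thesis
    by (simp add: is_union_def subobjects_def)
qed

section \<open>The Tarski-Vaught criterion for spans\<close>

locale subobject_family =
  C: coherent_category C + D: coherent_category D + M: coherent_functor C D M
  for C :: "('o, 'm) cat" and D :: "('p, 'n) cat" and M :: "('o, 'm, 'p, 'n) ftor" +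
  fixes N :: "'o \<Rightarrow> 'p" and \<alpha> :: "'o \<Rightarrow> 'n"
  assumes alpha: "x \<in> Obj C \<Longrightarrow> mono_arr D (\<alpha> x) \<and> in_hom D (\<alpha> x) (N x) (FObj M x)"
begin

lemma alpha_simps [simp]:
  assumes "x \<in> Obj C"
  shows "\<alpha> x \<in> Arr D" "Dom D (\<alpha> x) = N x" "Cod D (\<alpha> x) = FObj M x" "mono_arr D (\<alpha> x)"
    "N x \<in> Obj D"
  using alpha[OF assms] D.Dom_Obj[of "\<alpha> x"] by (auto simp: in_hom_def)

lemma alpha_cancel:
  assumes "x \<in> Obj C" "in_hom D g t (N x)" "in_hom D h t (N x)" "\<alpha> x \<cdot>\<^bsub>D\<^esub> g = \<alpha> x \<cdot>\<^bsub>D\<^esub> h"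
  shows "g = h"
  using D.mono_arrD[of "\<alpha> x" g t h] assms by simp

text \<open>
  The criterion for the formula \<open>\<exists>x. \<phi>(x, y)\<close>, where \<open>\<phi>\<close> is the subobject \<open>(a, b)\<close> of
  \<open>x \<times> y\<close> with domain \<open>z\<close>. Since \<open>M x \<times> N y\<close> imposes a condition on the second
  coordinate only, \<open>s\<close> is a pullback of \<open>M b\<close> and \<open>\<alpha> y\<close>; requiring in addition that the
  first coordinate lie in \<open>N x\<close> cuts out \<open>q\<close>. In applications this removes products and the
  subobjects \<open>M x \<times> N y\<close> and \<open>N x \<times> N y\<close> from view.
\<close>

lemma tarski_vaught_span:
  assumes TV: "tarski_vaught C D M N \<alpha>"
    and a: "in_hom C a z x" and b: "in_hom C b z y"
    and jm: "\<And>t g h. in_hom C g t z \<Longrightarrow> in_hom C h t z \<Longrightarrow> a \<cdot>\<^bsub>C\<^esub> g = a \<cdot>\<^bsub>C\<^esub> h \<Longrightarrow>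
               b \<cdot>\<^bsub>C\<^esub> g = b \<cdot>\<^bsub>C\<^esub> h \<Longrightarrow> g = h"
    and s: "is_pullback D (FArr M b) (\<alpha> y) sm w"
    and q: "is_pullback D (FArr M a \<cdot>\<^bsub>D\<^esub> sm) (\<alpha> x) j l"
    and im: "is_image_factorization D w f k"
  shows "effective_epi D (f \<cdot>\<^bsub>D\<^esub> j)"
proof -
  have xyz: "x \<in> Obj C" "y \<in> Obj C" "z \<in> Obj C" using C.in_hom_Obj[OF a] C.in_hom_Obj[OF b] by auto
  obtain p1 p2 where P: "is_product C x y p1 p2" using C.product_exists[OF xyz(1,2)] .
  note p = C.product_hom[OF P]
  obtain i where i: "in_hom C i z (Dom C p1)" and pi: "p1 \<cdot>\<^bsub>C\<^esub> i = a" "p2 \<cdot>\<^bsub>C\<^esub> i = b"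
    using C.product_lift[OF P a b] .
  have im_mono: "mono_arr C i"
    unfolding mono_arr_def
  proof (intro conjI allI impI)
    show "i \<in> Arr C" using i by (simp add: in_hom_def)
    fix t g h
    assume *: "in_hom C g t (Dom C i) \<and> in_hom C h t (Dom C i) \<and> i \<cdot>\<^bsub>C\<^esub> g = i \<cdot>\<^bsub>C\<^esub> h"
    then have "a \<cdot>\<^bsub>C\<^esub> g = a \<cdot>\<^bsub>C\<^esub> h" "b \<cdot>\<^bsub>C\<^esub> g = b \<cdot>\<^bsub>C\<^esub> h"
      using i p by (simp_all add: in_hom_def C.extend_eq[OF pi(1), symmetric] C.extend_eq[OF pi(2), symmetric])
    then show "g = h" using jm * i by (auto simp: in_hom_def)
  qed
  have MP: "is_product D (FObj M x) (FObj M y) (FArr M p1) (FArr M p2)"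
    using M.preserves_product[OF M.pres_finite_limits P] .
  obtain r1 r2 where R: "is_product D (FObj M x) (N y) r1 r2"
    using D.product_exists[of "FObj M x" "N y"] M.FObj_Obj xyz by auto
  obtain t1 t2 where T: "is_product D (N x) (N y) t1 t2"
    using D.product_exists[of "N x" "N y"] xyz by auto
  note r = D.product_hom[OF R] and t = D.product_hom[OF T]
  have MO: "FObj M x \<in> Obj D" "FObj M y \<in> Obj D" using M.FObj_Obj xyz by auto
  note A = p[unfolded in_hom_def] i[unfolded in_hom_def] a[unfolded in_hom_def] b[unfolded in_hom_def]
    r[unfolded in_hom_def] t[unfolded in_hom_def] xyz MO
  obtain u where u: "in_hom D u (Dom D r1) (FObj M (Dom C p1))"
      "FArr M p1 \<cdot>\<^bsub>D\<^esub> u = Ident D (FObj M x) \<cdot>\<^bsub>D\<^esub> r1" "FArr M p2 \<cdot>\<^bsub>D\<^esub> u = \<alpha> y \<cdot>\<^bsub>D\<^esub> r2"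
    by (rule D.product_lift[OF MP, of "Ident D (FObj M x) \<cdot>\<^bsub>D\<^esub> r1" "Dom D r1" "\<alpha> y \<cdot>\<^bsub>D\<^esub> r2"])
      (use A in \<open>simp_all add: in_hom_def\<close>)
  obtain v where v: "in_hom D v (Dom D t1) (FObj M (Dom C p1))"
      "FArr M p1 \<cdot>\<^bsub>D\<^esub> v = \<alpha> x \<cdot>\<^bsub>D\<^esub> t1" "FArr M p2 \<cdot>\<^bsub>D\<^esub> v = \<alpha> y \<cdot>\<^bsub>D\<^esub> t2"
    by (rule D.product_lift[OF MP, of "\<alpha> x \<cdot>\<^bsub>D\<^esub> t1" "Dom D t1" "\<alpha> y \<cdot>\<^bsub>D\<^esub> t2"])
      (use A in \<open>simp_all add: in_hom_def\<close>)
  have Ma: "FArr M p1 \<cdot>\<^bsub>D\<^esub> FArr M i = FArr M a" and Mb: "FArr M p2 \<cdot>\<^bsub>D\<^esub> FArr M i = FArr M b"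
    using A pi M.FArr_Comp'[of i p1] M.FArr_Comp'[of i p2] by auto
  let ?s = "Dom D sm" and ?q = "Dom D j"
  have sm: "in_hom D sm ?s (FObj M z)" and w: "in_hom D w ?s (N y)"
    and sw: "FArr M b \<cdot>\<^bsub>D\<^esub> sm = \<alpha> y \<cdot>\<^bsub>D\<^esub> w"
    using D.pullback_hom[OF s] A by (auto simp: in_hom_def)
  have j: "in_hom D j ?q ?s" and l: "in_hom D l ?q (N x)"
    and jl: "(FArr M a \<cdot>\<^bsub>D\<^esub> sm) \<cdot>\<^bsub>D\<^esub> j = \<alpha> x \<cdot>\<^bsub>D\<^esub> l"
    using D.pullback_hom[OF q] A sm by (auto simp: in_hom_def)
  have jl': "FArr M a \<cdot>\<^bsub>D\<^esub> (sm \<cdot>\<^bsub>D\<^esub> j) = \<alpha> x \<cdot>\<^bsub>D\<^esub> l"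
    using jl j sm A by (simp add: in_hom_def)
  note B = A u(1)[unfolded in_hom_def] v(1)[unfolded in_hom_def] sm[unfolded in_hom_def] w[unfolded in_hom_def]
    j[unfolded in_hom_def] l[unfolded in_hom_def]
  obtain sn where sn: "in_hom D sn ?s (Dom D r1)" "r1 \<cdot>\<^bsub>D\<^esub> sn = FArr M a \<cdot>\<^bsub>D\<^esub> sm" "r2 \<cdot>\<^bsub>D\<^esub> sn = w"
    by (rule D.product_lift[OF R, of "FArr M a \<cdot>\<^bsub>D\<^esub> sm" ?s w]) (use B in \<open>simp_all add: in_hom_def\<close>)
  obtain qn where qn: "in_hom D qn ?q (Dom D t1)" "t1 \<cdot>\<^bsub>D\<^esub> qn = l" "t2 \<cdot>\<^bsub>D\<^esub> qn = w \<cdot>\<^bsub>D\<^esub> j"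
    by (rule D.product_lift[OF T, of l ?q "w \<cdot>\<^bsub>D\<^esub> j"]) (use B in \<open>simp_all add: in_hom_def\<close>)
  note B = B sn(1)[unfolded in_hom_def] qn(1)[unfolded in_hom_def]
  note E = D.extend_eq[OF u(2)] D.extend_eq[OF u(3)] D.extend_eq[OF v(2)] D.extend_eq[OF v(3)]
    D.extend_eq[OF Ma] D.extend_eq[OF Mb] D.extend_eq[OF sn(2)] D.extend_eq[OF sn(3)]
    D.extend_eq[OF qn(2)] D.extend_eq[OF qn(3)]
  \<comment> \<open>The leg into \<open>M x \<times> N y\<close> has first coordinate \<open>M a\<close>, so a commuting square over \<open>u\<close>
      is determined by one over \<open>\<alpha> y\<close>.\<close>
  have S: "is_pullback D (FArr M i) u sm sn"
  proof (rule D.pullbackI[where a = "FObj M z" and b = "Dom D r1" and c = "FObj M (Dom C p1)" and d = ?s])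
    show "FArr M i \<cdot>\<^bsub>D\<^esub> sm = u \<cdot>\<^bsub>D\<^esub> sn"
      by (rule D.product_ext[OF MP, of _ ?s]) (use B E sn sw in \<open>simp_all add: in_hom_def\<close>)
  next
    fix t h k
    assume h: "in_hom D h t (FObj M z)" and k: "in_hom D k t (Dom D r1)"
      and hk: "FArr M i \<cdot>\<^bsub>D\<^esub> h = u \<cdot>\<^bsub>D\<^esub> k"
    have hk1: "FArr M a \<cdot>\<^bsub>D\<^esub> h = r1 \<cdot>\<^bsub>D\<^esub> k"
      using arg_cong[OF hk, of "\<lambda>e. FArr M p1 \<cdot>\<^bsub>D\<^esub> e"] h k B E by (simp add: in_hom_def)
    have hk2: "FArr M b \<cdot>\<^bsub>D\<^esub> h = \<alpha> y \<cdot>\<^bsub>D\<^esub> (r2 \<cdot>\<^bsub>D\<^esub> k)"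
      using arg_cong[OF hk, of "\<lambda>e. FArr M p2 \<cdot>\<^bsub>D\<^esub> e"] h k B E by (simp add: in_hom_def)
    obtain g where g: "in_hom D g t ?s" "sm \<cdot>\<^bsub>D\<^esub> g = h" "w \<cdot>\<^bsub>D\<^esub> g = r2 \<cdot>\<^bsub>D\<^esub> k"
      by (rule D.pullback_lift[OF s, of h t "r2 \<cdot>\<^bsub>D\<^esub> k"]) (use B h k hk2 in \<open>simp_all add: in_hom_def\<close>)
    have "sn \<cdot>\<^bsub>D\<^esub> g = k"
      by (rule D.product_ext[OF R, of _ t]) (use B g k hk1 E in \<open>simp_all add: in_hom_def\<close>)
    then show "\<exists>u. in_hom D u t ?s \<and> sm \<cdot>\<^bsub>D\<^esub> u = h \<and> sn \<cdot>\<^bsub>D\<^esub> u = k" using g by blast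
  next
    fix t g g'
    assume g: "in_hom D g t ?s" "in_hom D g' t ?s" and sg: "sm \<cdot>\<^bsub>D\<^esub> g = sm \<cdot>\<^bsub>D\<^esub> g'"
      and ng: "sn \<cdot>\<^bsub>D\<^esub> g = sn \<cdot>\<^bsub>D\<^esub> g'"
    have "w \<cdot>\<^bsub>D\<^esub> g = w \<cdot>\<^bsub>D\<^esub> g'"
      using arg_cong[OF ng, of "\<lambda>e. r2 \<cdot>\<^bsub>D\<^esub> e"] g B E by (simp add: in_hom_def)
    then show "g = g'" using D.pullback_ext[OF s g sg] by blast
  qed (use B in \<open>simp_all add: in_hom_def\<close>)
  have Q: "is_pullback D (FArr M i) v (sm \<cdot>\<^bsub>D\<^esub> j) qn"
  proof (rule D.pullbackI[where a = "FObj M z" and b = "Dom D t1" and c = "FObj M (Dom C p1)" and d = ?q])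
    have swj: "FArr M b \<cdot>\<^bsub>D\<^esub> (sm \<cdot>\<^bsub>D\<^esub> j) = \<alpha> y \<cdot>\<^bsub>D\<^esub> (w \<cdot>\<^bsub>D\<^esub> j)"
      using D.extend_eq[OF sw, of j] B by simp
    show "FArr M i \<cdot>\<^bsub>D\<^esub> (sm \<cdot>\<^bsub>D\<^esub> j) = v \<cdot>\<^bsub>D\<^esub> qn"
      by (rule D.product_ext[OF MP, of _ ?q]) (use B E qn jl' swj in \<open>simp_all add: in_hom_def\<close>)
  next
    fix t h k
    assume h: "in_hom D h t (FObj M z)" and k: "in_hom D k t (Dom D t1)"
      and hk: "FArr M i \<cdot>\<^bsub>D\<^esub> h = v \<cdot>\<^bsub>D\<^esub> k"
    have hk1: "FArr M a \<cdot>\<^bsub>D\<^esub> h = \<alpha> x \<cdot>\<^bsub>D\<^esub> (t1 \<cdot>\<^bsub>D\<^esub> k)"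
      using arg_cong[OF hk, of "\<lambda>e. FArr M p1 \<cdot>\<^bsub>D\<^esub> e"] h k B E by (simp add: in_hom_def)
    have hk2: "FArr M b \<cdot>\<^bsub>D\<^esub> h = \<alpha> y \<cdot>\<^bsub>D\<^esub> (t2 \<cdot>\<^bsub>D\<^esub> k)"
      using arg_cong[OF hk, of "\<lambda>e. FArr M p2 \<cdot>\<^bsub>D\<^esub> e"] h k B E by (simp add: in_hom_def)
    obtain g where g: "in_hom D g t ?s" "sm \<cdot>\<^bsub>D\<^esub> g = h" "w \<cdot>\<^bsub>D\<^esub> g = t2 \<cdot>\<^bsub>D\<^esub> k"
      by (rule D.pullback_lift[OF s, of h t "t2 \<cdot>\<^bsub>D\<^esub> k"]) (use B h k hk2 in \<open>simp_all add: in_hom_def\<close>)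
    obtain g' where g': "in_hom D g' t ?q" "j \<cdot>\<^bsub>D\<^esub> g' = g" "l \<cdot>\<^bsub>D\<^esub> g' = t1 \<cdot>\<^bsub>D\<^esub> k"
      by (rule D.pullback_lift[OF q, of g t "t1 \<cdot>\<^bsub>D\<^esub> k"]) (use B h k hk1 g in \<open>simp_all add: in_hom_def\<close>)
    have "qn \<cdot>\<^bsub>D\<^esub> g' = k"
      by (rule D.product_ext[OF T, of _ t]) (use B g g' k E in \<open>simp_all add: in_hom_def\<close>)
    moreover have "(sm \<cdot>\<^bsub>D\<^esub> j) \<cdot>\<^bsub>D\<^esub> g' = h"
      using B g g' by (simp add: in_hom_def)
    ultimately show "\<exists>u. in_hom D u t ?q \<and> (sm \<cdot>\<^bsub>D\<^esub> j) \<cdot>\<^bsub>D\<^esub> u = h \<and> qn \<cdot>\<^bsub>D\<^esub> u = k"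
      using g' by blast
  next
    fix t g g'
    assume g: "in_hom D g t ?q" "in_hom D g' t ?q"
      and sg: "(sm \<cdot>\<^bsub>D\<^esub> j) \<cdot>\<^bsub>D\<^esub> g = (sm \<cdot>\<^bsub>D\<^esub> j) \<cdot>\<^bsub>D\<^esub> g'" and ng: "qn \<cdot>\<^bsub>D\<^esub> g = qn \<cdot>\<^bsub>D\<^esub> g'"
    have lg: "l \<cdot>\<^bsub>D\<^esub> g = l \<cdot>\<^bsub>D\<^esub> g'" and wg: "w \<cdot>\<^bsub>D\<^esub> (j \<cdot>\<^bsub>D\<^esub> g) = w \<cdot>\<^bsub>D\<^esub> (j \<cdot>\<^bsub>D\<^esub> g')"
      using arg_cong[OF ng, of "\<lambda>e. t1 \<cdot>\<^bsub>D\<^esub> e"] arg_cong[OF ng, of "\<lambda>e. t2 \<cdot>\<^bsub>D\<^esub> e"] g B E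
      by (simp_all add: in_hom_def)
    have "j \<cdot>\<^bsub>D\<^esub> g = j \<cdot>\<^bsub>D\<^esub> g'"
      by (rule D.pullback_ext[OF s, of _ t]) (use g B sg wg in \<open>simp_all add: in_hom_def\<close>)
    then show "g = g'" using D.pullback_ext[OF q g _ lg] by blast
  qed (use B in \<open>simp_all add: in_hom_def\<close>)
  have "is_product_arr D r1 r2 (FArr M p1) (FArr M p2) (Ident D (FObj M x)) (\<alpha> y) u"
    and "is_product_arr D t1 t2 (FArr M p1) (FArr M p2) (\<alpha> x) (\<alpha> y) v"
    using u v A by (auto simp: is_product_arr_def in_hom_def)
  moreover have "in_hom D j (Dom D (sm \<cdot>\<^bsub>D\<^esub> j)) (Dom D sm)" "is_image_factorization D (r2 \<cdot>\<^bsub>D\<^esub> sn) f k"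
    using B im sn by (auto simp: in_hom_def)
  ultimately show ?thesis
    using TV[unfolded tarski_vaught_def, rule_format, OF xyz(1,2),
        of p1 p2 i r1 r2 u t1 t2 v sm sn "sm \<cdot>\<^bsub>D\<^esub> j" qn j f k]
      P im_mono i R T S Q by (auto simp: in_hom_def)
qed


section \<open>The induced functor\<close>

text \<open>
  The criterion for \<open>\<exists>y'. y' = f(x')\<close>, that is, for the span \<open>y \<leftarrow> x \<rightarrow> x\<close> of \<open>f\<close> and the
  identity, in which \<open>s\<close> is \<open>N x\<close> itself. The part \<open>q\<close> of \<open>N x\<close> that lands in \<open>N y\<close>
  is a subobject of \<open>N x\<close>, and the criterion makes it an effective epimorphism onto
  \<open>N x\<close>. It is thus all of \<open>N x\<close>, and its leg into \<open>N y\<close> is the restriction of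
  \<open>M f\<close>.
\<close>

lemma restriction_exists:
  assumes TV: "tarski_vaught C D M N \<alpha>" and f: "in_hom C f x y"
  shows "\<exists>g. in_hom D g (N x) (N y) \<and> \<alpha> y \<cdot>\<^bsub>D\<^esub> g = FArr M f \<cdot>\<^bsub>D\<^esub> \<alpha> x"
proof -
  have xy: "x \<in> Obj C" "y \<in> Obj C" using C.in_hom_Obj[OF f] by auto
  note A = xy f[unfolded in_hom_def]
  have "in_hom D (\<alpha> x) (N x) (FObj M x)" using alpha xy by simp
  from D.pullback_sym[OF D.pullback_Ident[OF this]]
  have s: "is_pullback D (FArr M (Ident C x)) (\<alpha> x) (\<alpha> x) (Ident D (N x))"
    using M.FArr_Ident xy by simp
  obtain j l where q: "is_pullback D (FArr M f \<cdot>\<^bsub>D\<^esub> \<alpha> x) (\<alpha> y) j l"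
    by (rule D.pullback_exists[of "FArr M f \<cdot>\<^bsub>D\<^esub> \<alpha> x" "N x" "FObj M y" "\<alpha> y" "N y"])
      (use A in \<open>simp_all add: in_hom_def\<close>)
  have im: "is_image_factorization D (Ident D (N x)) (Ident D (N x)) (Ident D (N x))"
    using D.image_Ident_mono[OF D.mono_arr_Ident[of "N x"]] xy by simp
  have jl: "in_hom D j (Dom D j) (N x)" "in_hom D l (Dom D j) (N y)"
    "FArr M f \<cdot>\<^bsub>D\<^esub> (\<alpha> x \<cdot>\<^bsub>D\<^esub> j) = \<alpha> y \<cdot>\<^bsub>D\<^esub> l"
    using D.pullback_hom[OF q] A by (auto simp: in_hom_def)
  have "effective_epi D (Ident D (N x) \<cdot>\<^bsub>D\<^esub> j)"
    by (rule tarski_vaught_span[OF TV f C.Ident_in_hom[OF xy(1)] _ s q im])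
      (simp add: in_hom_def)
  then have "effective_epi D j" using jl by (simp add: in_hom_def)
  moreover have "mono_arr D j" using D.pullback_mono[OF q] xy by simp
  ultimately have "iso_arr D j" by (rule D.mono_effective_epi_iso)
  then obtain j' where j': "in_hom D j' (N x) (Dom D j)" "j \<cdot>\<^bsub>D\<^esub> j' = Ident D (N x)"
    using jl unfolding iso_arr_def by (auto simp: in_hom_def)
  have "\<alpha> y \<cdot>\<^bsub>D\<^esub> (l \<cdot>\<^bsub>D\<^esub> j') = FArr M f \<cdot>\<^bsub>D\<^esub> \<alpha> x"
    using A jl(1,2) j' D.extend_eq[OF jl(3)[symmetric], of j'] by (simp add: in_hom_def)
  then show ?thesis using jl j' by (intro exI[of _ "l \<cdot>\<^bsub>D\<^esub> j'"]) (simp add: in_hom_def)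
qed

text \<open>
  Functoriality is automatic for naturality squares over a monic \<open>\<alpha>\<close>: both sides of each functor
  law have the same composite with \<open>\<alpha>\<close>.
\<close>

lemma functorial_extension_iff:
  "functorial_extension C D M N \<alpha> h \<longleftrightarrow>
     (\<forall>f\<in>Arr C. in_hom D (h f) (N (Dom C f)) (N (Cod C f)) \<and>
        \<alpha> (Cod C f) \<cdot>\<^bsub>D\<^esub> h f = FArr M f \<cdot>\<^bsub>D\<^esub> \<alpha> (Dom C f))" (is "_ \<longleftrightarrow> ?R")
proof
  assume "functorial_extension C D M N \<alpha> h"
  then have F: "is_functor C D \<lparr>FObj = N, FArr = h\<rparr>" and T: "nat_trans C D \<lparr>FObj = N, FArr = h\<rparr> M \<alpha>"
    unfolding functorial_extension_def by auto
  have "in_hom D (h f) (N (Dom C f)) (N (Cod C f))" if "f \<in> Arr C" for f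
    using is_functor.FArr_in_hom[OF F, of f "Dom C f" "Cod C f"] that by (simp add: in_hom_def)
  then show ?R using T by (simp add: nat_trans_def)
next
  assume R: ?R
  have H: "in_hom D (h f) (N a) (N b)" "\<alpha> b \<cdot>\<^bsub>D\<^esub> h f = FArr M f \<cdot>\<^bsub>D\<^esub> \<alpha> a" if "in_hom C f a b" for f a b
    using R that by (auto simp: in_hom_def)
  have "is_functor C D \<lparr>FObj = N, FArr = h\<rparr>"
  proof (unfold_locales, goal_cases)
    case (3 x)
    have "h (Ident C x) = Ident D (N x)"
      by (rule alpha_cancel[OF 3, of _ "N x"])
        (use H[OF C.Ident_in_hom[OF 3]] 3 M.FArr_Ident[OF 3] M.FObj_Obj[OF 3] in \<open>simp_all add: in_hom_def\<close>)
    then show ?case by simp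
  next
    case (4 f a b g c)
    note f = 4(1) and g = 4(2)
    have gf: "in_hom C (g \<cdot>\<^bsub>C\<^esub> f) a c" using C.Comp_in_hom f g by blast
    note Hf = H[OF f] and Hg = H[OF g] and Hgf = H[OF gf]
    have O: "a \<in> Obj C" "b \<in> Obj C" "c \<in> Obj C" using C.in_hom_Obj f g by blast+
    have "\<alpha> c \<cdot>\<^bsub>D\<^esub> (h g \<cdot>\<^bsub>D\<^esub> h f) = FArr M g \<cdot>\<^bsub>D\<^esub> (\<alpha> b \<cdot>\<^bsub>D\<^esub> h f)"
      using D.extend_eq[OF Hg(2), of "h f"] Hf(1) Hg(1) O g by (simp add: in_hom_def)
    also have "\<dots> = \<alpha> c \<cdot>\<^bsub>D\<^esub> h (g \<cdot>\<^bsub>C\<^esub> f)"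
      using Hf Hgf(2) f g O by (simp add: in_hom_def)
    finally have "h g \<cdot>\<^bsub>D\<^esub> h f = h (g \<cdot>\<^bsub>C\<^esub> f)"
      by (rule alpha_cancel[OF O(3), rotated 2, where t = "N a"])
        (use Hf(1) Hg(1) Hgf(1) in \<open>simp_all add: in_hom_def\<close>)
    then show ?case by simp
  qed (use H in auto)
  then show "functorial_extension C D M N \<alpha> h"
    using R alpha by (simp add: functorial_extension_def nat_trans_def)
qed

lemma functorial_extension_exists:
  assumes "tarski_vaught C D M N \<alpha>"
  obtains h where "functorial_extension C D M N \<alpha> h"
proof -
  have "\<forall>f\<in>Arr C. \<exists>g. in_hom D g (N (Dom C f)) (N (Cod C f)) \<and>
      \<alpha> (Cod C f) \<cdot>\<^bsub>D\<^esub> g = FArr M f \<cdot>\<^bsub>D\<^esub> \<alpha> (Dom C f)"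
    using restriction_exists[OF assms] by (simp add: in_hom_def)
  then show ?thesis using that unfolding functorial_extension_iff by metis
qed

lemma functorial_extension_unique:
  assumes "functorial_extension C D M N \<alpha> h" "functorial_extension C D M N \<alpha> h'" "f \<in> Arr C"
  shows "h' f = h f"
  using assms alpha_cancel[of "Cod C f" "h' f" "N (Dom C f)" "h f"] C.Cod_Obj[of f]
  unfolding functorial_extension_iff by metis

end

locale natural_subfamily = subobject_family C D M N \<alpha>
  for C :: "('o, 'm) cat" and D :: "('p, 'n) cat" and M :: "('o, 'm, 'p, 'n) ftor"
    and N :: "'o \<Rightarrow> 'p" and \<alpha> :: "'o \<Rightarrow> 'n" +
  fixes h :: "'m \<Rightarrow> 'n"
  assumes ext: "functorial_extension C D M N \<alpha> h"
begin

abbreviation "NF \<equiv> \<lparr>FObj = N, FArr = h\<rparr>"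

sublocale N: is_functor C D NF
  using ext by (simp add: functorial_extension_def)

lemma h_simps [simp]:
  assumes "f \<in> Arr C"
  shows "h f \<in> Arr D" "Dom D (h f) = N (Dom C f)" "Cod D (h f) = N (Cod C f)"
  using N.FArr_simps[OF assms] by simp_all

lemma natural: "in_hom C f a b \<Longrightarrow> \<alpha> b \<cdot>\<^bsub>D\<^esub> h f = FArr M f \<cdot>\<^bsub>D\<^esub> \<alpha> a"
  using ext unfolding functorial_extension_iff in_hom_def by blast

lemma h_mono:
  assumes "mono_arr C i"
  shows "mono_arr D (h i)"
proof -
  have i: "i \<in> Arr C" "in_hom C i (Dom C i) (Cod C i)"
    using C.mono_arr_Arr[OF assms] by (auto simp: in_hom_def)
  have O: "Dom C i \<in> Obj C" "Cod C i \<in> Obj C" using C.in_hom_Obj[OF i(2)] by auto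
  have "mono_arr D (FArr M i \<cdot>\<^bsub>D\<^esub> \<alpha> (Dom C i))"
    using M.preserves_mono[OF assms] i O by (intro D.mono_arr_Comp) simp_all
  then show ?thesis
    using i O by (intro D.mono_arr_cancel[of "\<alpha> (Cod C i)" "h i"]) (simp_all add: natural)
qed

text \<open>
  The criterion for \<open>\<exists>x'. y' = b(x')\<close>, that is, for the graph of \<open>b\<close>. Here \<open>q\<close> is
  \<open>N x\<close>, since \<open>b\<close> already maps \<open>N x\<close> into \<open>N y\<close>.
\<close>

lemma tarski_vaught_arrow:
  assumes TV: "tarski_vaught C D M N \<alpha>" and b: "in_hom C b x y"
    and s: "is_pullback D (FArr M b) (\<alpha> y) sm w" and im: "is_image_factorization D w f k"
  obtains j where "in_hom D j (N x) (Dom D sm)" "sm \<cdot>\<^bsub>D\<^esub> j = \<alpha> x" "w \<cdot>\<^bsub>D\<^esub> j = h b"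
    "effective_epi D (f \<cdot>\<^bsub>D\<^esub> j)"
proof -
  have xy: "x \<in> Obj C" "y \<in> Obj C" using C.in_hom_Obj[OF b] by auto
  note A = xy b[unfolded in_hom_def]
  obtain j where j: "in_hom D j (N x) (Dom D sm)" "sm \<cdot>\<^bsub>D\<^esub> j = \<alpha> x" "w \<cdot>\<^bsub>D\<^esub> j = h b"
    by (rule D.pullback_lift[OF s, of "\<alpha> x" "N x" "h b"])
      (use A natural[OF b] in \<open>simp_all add: in_hom_def\<close>)
  have sm: "mono_arr D sm" "sm \<in> Arr D" "Cod D sm = FObj M x"
    using D.pullback_mono[OF s] D.pullback_hom[OF s] A by (auto simp: in_hom_def)
  have "FArr M (Ident C x) \<cdot>\<^bsub>D\<^esub> sm = sm" using sm M.FArr_Ident xy by simp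
  then have q: "is_pullback D (FArr M (Ident C x) \<cdot>\<^bsub>D\<^esub> sm) (\<alpha> x) j (Ident D (N x))"
    using D.pullback_factor_mono[OF sm(1) j(1,2)] by simp
  have "effective_epi D (f \<cdot>\<^bsub>D\<^esub> j)"
    by (rule tarski_vaught_span[OF TV C.Ident_in_hom[OF xy(1)] b _ s q im])
      (simp add: in_hom_def)
  then show ?thesis using that j by blast
qed

text \<open>
  For a monomorphism \<open>i\<close> the pullback \<open>s\<close> of \<open>M i\<close> is a subobject of \<open>N x\<close>, hence its
  own image, and \<open>N a \<rightarrow> s\<close> is monic and an effective epimorphism.
\<close>

lemma tarski_vaught_imp_elementary:
  assumes TV: "tarski_vaught C D M N \<alpha>"
  shows "elementary C D NF M \<alpha>"
  unfolding elementary_def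
proof (intro allI impI)
  fix i assume m: "mono_arr C i"
  have i: "i \<in> Arr C" "in_hom C i (Dom C i) (Cod C i)"
    using C.mono_arr_Arr[OF m] by (auto simp: in_hom_def)
  have O: "Dom C i \<in> Obj C" "Cod C i \<in> Obj C" using C.in_hom_Obj[OF i(2)] by auto
  obtain sm w where s: "is_pullback D (FArr M i) (\<alpha> (Cod C i)) sm w"
    by (rule D.pullback_exists[of "FArr M i" _ "FObj M (Cod C i)" "\<alpha> (Cod C i)"])
      (use i O in \<open>simp_all add: in_hom_def\<close>)
  have w: "mono_arr D w" "Dom D w = Dom D sm"
    using D.pullback_mono[OF D.pullback_sym[OF s] M.preserves_mono[OF m]] D.pullback_hom[OF s]
    by (auto simp: in_hom_def)
  obtain j where j: "in_hom D j (N (Dom C i)) (Dom D sm)" "sm \<cdot>\<^bsub>D\<^esub> j = \<alpha> (Dom C i)" "w \<cdot>\<^bsub>D\<^esub> j = h i"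
    "effective_epi D (Ident D (Dom D w) \<cdot>\<^bsub>D\<^esub> j)"
    using tarski_vaught_arrow[OF TV i(2) s D.image_Ident_mono[OF w(1)]] .
  have "effective_epi D j" using j(1,4) w by (simp add: in_hom_def)
  moreover have "mono_arr D j"
    by (rule D.mono_arr_cancel[of sm]) (use j D.pullback_hom[OF s] O in \<open>simp_all add: in_hom_def\<close>)
  ultimately have "iso_arr D j" by (rule D.mono_effective_epi_iso)
  from D.pullback_iso[OF s this] j
  show "is_pullback D (FArr M i) (\<alpha> (Cod C i)) (\<alpha> (Dom C i)) (FArr NF i)"
    by (simp add: in_hom_def)
qed

text \<open>
  The pullback \<open>w\<close> of \<open>M e\<close> along \<open>\<alpha> y\<close> is an effective epimorphism, so it is its own
  image factorization, and its composite with \<open>N x \<rightarrow> s\<close> is \<open>N e\<close>.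
\<close>

lemma tarski_vaught_imp_effective_epi:
  assumes TV: "tarski_vaught C D M N \<alpha>" and e: "effective_epi C e"
  shows "effective_epi D (h e)"
proof -
  have i: "e \<in> Arr C" "in_hom C e (Dom C e) (Cod C e)"
    using C.effective_epi_Arr[OF e] by (auto simp: in_hom_def)
  have O: "Dom C e \<in> Obj C" "Cod C e \<in> Obj C" using C.in_hom_Obj[OF i(2)] by auto
  obtain sm w where s: "is_pullback D (FArr M e) (\<alpha> (Cod C e)) sm w"
    by (rule D.pullback_exists[of "FArr M e" _ "FObj M (Cod C e)" "\<alpha> (Cod C e)"])
      (use i O in \<open>simp_all add: in_hom_def\<close>)
  have "effective_epi D w"
    using D.effective_epi_pullback[OF M.pres_effective_epi[OF e] D.pullback_sym[OF s]] .
  from tarski_vaught_arrow[OF TV i(2) s D.image_effective_epi_Ident[OF this]]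
  show ?thesis by metis
qed


section \<open>Unions and finite limits\<close>

lemma elementary_pullback:
  assumes "elementary C D NF M \<alpha>" "mono_arr C i" "in_hom C i a x"
  shows "is_pullback D (FArr M i) (\<alpha> x) (\<alpha> a) (h i)"
  using assms by (auto simp: elementary_def in_hom_def)

text \<open>
  By elementarity \<open>N a\<close> is the pullback of \<open>M a\<close> along \<open>\<alpha> x\<close>, so stability of unions
  applies.
\<close>

lemma elementary_imp_preserves_unions:
  assumes E: "elementary C D NF M \<alpha>" and fin: "finite A" and U: "is_union C x A u"
  shows "is_union D (N x) (h ` A) (h u)"
proof -
  have sub: "mono_arr C a \<and> in_hom C a (Dom C a) x" if "a \<in> insert u A" for a
    using U that C.mono_arr_Arr by (auto simp: is_union_def subobjects_def in_hom_def)
  have x: "x \<in> Obj C" using sub[of u] C.in_hom_Obj by blast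
  have pb: "is_pullback D (\<alpha> x) (FArr M a) (h a) (\<alpha> (Dom C a))" if "a \<in> insert u A" for a
    using D.pullback_sym[OF elementary_pullback[OF E]] sub[OF that] by blast
  \<comment> \<open>Stability of unions wants one pullback for each arrow \<open>M a\<close>, but distinct \<open>a\<close> may have
      equal \<open>M a\<close>. The chosen representatives \<open>?r c\<close> already generate the union; the other
      \<open>N a\<close> lie below \<open>N u\<close> by functoriality.\<close>
  let ?r = "\<lambda>c. SOME a. a \<in> A \<and> FArr M a = c"
  have r: "?r c \<in> A \<and> FArr M (?r c) = c" if "c \<in> FArr M ` A" for c
    using that by (intro someI_ex[of "\<lambda>a. a \<in> A \<and> FArr M a = c"]) blast
  have "is_union D (N x) ((\<lambda>c. h (?r c)) ` (FArr M ` A)) (h u)"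
  proof (rule D.finite_unions_stable)
    show "is_union D (FObj M x) (FArr M ` A) (FArr M u)"
      using M.pres_finite_unions[OF fin U] .
    show "in_hom D (\<alpha> x) (N x) (FObj M x)" using alpha x by simp
    show "is_pullback D (\<alpha> x) (FArr M u) (h u) (\<alpha> (Dom C u))" using pb by simp
    show "\<exists>k. is_pullback D (\<alpha> x) c (h (?r c)) k" if "c \<in> FArr M ` A" for c
      using pb[of "?r c"] r[OF that] by auto
  qed (use fin in simp)
  then have u: "h u \<in> subobjects D (N x)"
    and least: "\<And>v. v \<in> subobjects D (N x) \<Longrightarrow> (\<forall>a\<in>A. sub_le D (h a) v) \<Longrightarrow> sub_le D (h u) v"
    using r by (auto simp: is_union_def)
  have "h a \<in> subobjects D (N x)" if "a \<in> A" for a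
    using sub[of a] h_mono[of a] that by (auto simp: subobjects_def in_hom_def)
  moreover have "sub_le D (h a) (h u)" if a: "a \<in> A" for a
  proof -
    obtain g where g: "in_hom C g (Dom C a) (Dom C u)" "u \<cdot>\<^bsub>C\<^esub> g = a"
      using U a by (auto simp: is_union_def sub_le_def)
    have A: "u \<in> Arr C" "a \<in> Arr C" using sub[of u] sub[of a] a by (auto simp: in_hom_def)
    have "h u \<cdot>\<^bsub>D\<^esub> h g = h a"
      using N.FArr_Comp'[of g u] A g by (simp add: in_hom_def)
    then show ?thesis
      unfolding sub_le_def using A g(1) by (intro exI[of _ "h g"]) (simp add: in_hom_def)
  qed
  ultimately show ?thesis using u least by (auto simp: is_union_def)
qed

text \<open>
  The isomorphism \<open>\<phi>\<close> is compatible with \<open>\<alpha>\<close> only; naturality and monicity of \<open>\<alpha>\<close> turn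
  this into compatibility with the projections \<open>N p1\<close> and \<open>N p2\<close>.
\<close>

lemma preserves_products_lift:
  assumes PP: "preserves_finite_products C D M N \<alpha>" and P: "is_product C x y p1 p2"
    and a: "in_hom D a t (N x)" and b: "in_hom D b t (N y)"
  obtains u where "in_hom D u t (N (Dom C p1))" "h p1 \<cdot>\<^bsub>D\<^esub> u = a" "h p2 \<cdot>\<^bsub>D\<^esub> u = b"
proof -
  note p = C.product_hom[OF P]
  have O: "x \<in> Obj C" "y \<in> Obj C" "Dom C p1 \<in> Obj C" using p C.in_hom_Obj by blast+
  have MO: "FObj M x \<in> Obj D" "FObj M y \<in> Obj D" "FObj M (Dom C p1) \<in> Obj D" using M.FObj_Obj O by auto
  have MP: "is_product D (FObj M x) (FObj M y) (FArr M p1) (FArr M p2)"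
    using M.preserves_product[OF M.pres_finite_limits P] .
  obtain t1 t2 where T: "is_product D (N x) (N y) t1 t2"
    using D.product_exists[of "N x" "N y"] O by auto
  note A = O MO p[unfolded in_hom_def] D.product_hom[OF T, unfolded in_hom_def]
    a[unfolded in_hom_def] b[unfolded in_hom_def]
  obtain v where v: "in_hom D v (Dom D t1) (FObj M (Dom C p1))"
      "FArr M p1 \<cdot>\<^bsub>D\<^esub> v = \<alpha> x \<cdot>\<^bsub>D\<^esub> t1" "FArr M p2 \<cdot>\<^bsub>D\<^esub> v = \<alpha> y \<cdot>\<^bsub>D\<^esub> t2"
    by (rule D.product_lift[OF MP, of "\<alpha> x \<cdot>\<^bsub>D\<^esub> t1" "Dom D t1" "\<alpha> y \<cdot>\<^bsub>D\<^esub> t2"])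
      (use A in \<open>simp_all add: in_hom_def\<close>)
  \<comment> \<open>With \<open>M p1, M p2\<close> as the chosen product of \<open>M x\<close> and \<open>M y\<close>, the canonical comparison
      is an identity.\<close>
  let ?I = "Ident D (FObj M (Dom C p1))"
  have "is_product_arr D t1 t2 (FArr M p1) (FArr M p2) (\<alpha> x) (\<alpha> y) v"
    using v A by (simp add: is_product_arr_def)
  then obtain \<phi> where \<phi>: "iso_arr D \<phi>" "in_hom D \<phi> (N (Dom C p1)) (Dom D t1)"
      "v \<cdot>\<^bsub>D\<^esub> \<phi> = ?I \<cdot>\<^bsub>D\<^esub> \<alpha> (Dom C p1)"
    using PP[unfolded preserves_finite_products_def, THEN conjunct2, rule_format, OF O(1,2) P,
        of t1 t2 "FArr M p1" "FArr M p2" v ?I] T MP A by (auto simp: in_hom_def)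
  then obtain \<psi> where \<psi>: "in_hom D \<psi> (Dom D t1) (N (Dom C p1))" "\<phi> \<cdot>\<^bsub>D\<^esub> \<psi> = Ident D (Dom D t1)"
    unfolding iso_arr_def by (auto simp: in_hom_def)
  obtain w where w: "in_hom D w t (Dom D t1)" "t1 \<cdot>\<^bsub>D\<^esub> w = a" "t2 \<cdot>\<^bsub>D\<^esub> w = b"
    using D.product_lift[OF T a b] .
  note B = A v(1)[unfolded in_hom_def] \<phi>(2)[unfolded in_hom_def] \<psi>(1)[unfolded in_hom_def] w(1)[unfolded in_hom_def]
  have v\<phi>: "v \<cdot>\<^bsub>D\<^esub> \<phi> = \<alpha> (Dom C p1)" using \<phi>(3) B by simp
  have lift: "h q \<cdot>\<^bsub>D\<^esub> (\<psi> \<cdot>\<^bsub>D\<^esub> w) = c"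
    if q: "in_hom C q (Dom C p1) z" and c: "in_hom D c t (N z)"
      and vq: "FArr M q \<cdot>\<^bsub>D\<^esub> (v \<cdot>\<^bsub>D\<^esub> w) = \<alpha> z \<cdot>\<^bsub>D\<^esub> c" for q z c
  proof -
    have z: "z \<in> Obj C" using C.in_hom_Obj[OF q] by simp
    have "\<alpha> (Dom C p1) \<cdot>\<^bsub>D\<^esub> (\<psi> \<cdot>\<^bsub>D\<^esub> w) = v \<cdot>\<^bsub>D\<^esub> w"
      using D.extend_eq[OF v\<phi>, of "\<psi> \<cdot>\<^bsub>D\<^esub> w"] D.extend_eq[OF \<psi>(2), of w] B by simp
    then have "\<alpha> z \<cdot>\<^bsub>D\<^esub> (h q \<cdot>\<^bsub>D\<^esub> (\<psi> \<cdot>\<^bsub>D\<^esub> w)) = \<alpha> z \<cdot>\<^bsub>D\<^esub> c"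
      using D.extend_eq[OF natural[OF q], of "\<psi> \<cdot>\<^bsub>D\<^esub> w"] vq q z B by (simp add: in_hom_def)
    then show ?thesis
      by (rule alpha_cancel[OF z, rotated 2, where t = t]) (use c q B in \<open>simp_all add: in_hom_def\<close>)
  qed
  have "h p1 \<cdot>\<^bsub>D\<^esub> (\<psi> \<cdot>\<^bsub>D\<^esub> w) = a"
    by (rule lift[OF p(1) a]) (use D.extend_eq[OF v(2), of w] w B in simp)
  moreover have "h p2 \<cdot>\<^bsub>D\<^esub> (\<psi> \<cdot>\<^bsub>D\<^esub> w) = b"
    by (rule lift[OF p(2) b]) (use D.extend_eq[OF v(3), of w] w B in simp)
  ultimately show ?thesis using that[of "\<psi> \<cdot>\<^bsub>D\<^esub> w"] B by (simp add: in_hom_def)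
qed

text \<open>
  The parts of the universal property of a product that embed a limit \<open>L\<close> into the product
  \<open>P\<close> of the vertices: existence in \<open>C\<close> provides \<open>L \<rightarrow> P\<close>, existence for \<open>N\<close> turns a cone
  into an arrow to \<open>N P\<close>, and uniqueness for \<open>M\<close> compares arrows into \<open>M P\<close>. In this form
  the property passes from \<open>S\<close> to \<open>insert k S\<close> by binary products.
\<close>

definition product_family :: "'i set \<Rightarrow> ('i \<Rightarrow> 'o) \<Rightarrow> 'o \<Rightarrow> ('i \<Rightarrow> 'm) \<Rightarrow> bool" where
  "product_family S X P p \<longleftrightarrow> P \<in> Obj C \<and> (\<forall>j\<in>S. in_hom C (p j) P (X j)) \<and>
    (\<forall>T \<tau>. T \<in> Obj C \<and> (\<forall>j\<in>S. in_hom C (\<tau> j) T (X j)) \<longrightarrow>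
       (\<exists>l. in_hom C l T P \<and> (\<forall>j\<in>S. p j \<cdot>\<^bsub>C\<^esub> l = \<tau> j))) \<and>
    (\<forall>T g g'. in_hom D g T (FObj M P) \<and> in_hom D g' T (FObj M P) \<and>
       (\<forall>j\<in>S. FArr M (p j) \<cdot>\<^bsub>D\<^esub> g = FArr M (p j) \<cdot>\<^bsub>D\<^esub> g') \<longrightarrow> g = g') \<and>
    (\<forall>T \<tau>. T \<in> Obj D \<and> (\<forall>j\<in>S. in_hom D (\<tau> j) T (N (X j))) \<longrightarrow>
       (\<exists>l. in_hom D l T (N P) \<and> (\<forall>j\<in>S. h (p j) \<cdot>\<^bsub>D\<^esub> l = \<tau> j)))"

lemma product_family_exists:
  assumes PP: "preserves_finite_products C D M N \<alpha>"
    and "finite S" "\<And>j. j \<in> S \<Longrightarrow> X j \<in> Obj C"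
  shows "\<exists>P p. product_family S X P p"
  using assms(2,3)
proof (induction S rule: finite_induct)
  case empty
  obtain e where e: "is_terminal C e" using C.terminal_exists .
  have Me: "is_terminal D (FObj M e)" using M.preserves_terminal[OF M.pres_finite_limits e] .
  have O: "e \<in> Obj C" using e by (simp add: is_terminal_def)
  have "iso_arr D (\<alpha> e)" using PP e by (simp add: preserves_finite_products_def)
  then obtain \<beta> where \<beta>: "in_hom D \<beta> (FObj M e) (N e)" using O unfolding iso_arr_def by auto
  have "\<exists>l. in_hom D l T (N e)" if T: "T \<in> Obj D" for T
  proof -
    obtain c where "in_hom D c T (FObj M e)" using Me T unfolding is_terminal_def by blast
    then show ?thesis using D.Comp_in_hom \<beta> by blast
  qed
  moreover have "\<exists>l. in_hom C l T e" if "T \<in> Obj C" for T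
    using e that unfolding is_terminal_def by blast
  moreover have "g = g'" if "in_hom D g T (FObj M e)" "in_hom D g' T (FObj M e)" for T g g'
    using Me that D.in_hom_Obj(1)[OF that(1)] unfolding is_terminal_def by blast
  ultimately have "product_family {} X e p" for p
    using O by (simp add: product_family_def) blast
  then show ?case by blast
next
  case (insert k S)
  then obtain P p where "product_family S X P p" by auto
  note Q = this[unfolded product_family_def]
  then have P: "P \<in> Obj C" and p: "\<And>j. j \<in> S \<Longrightarrow> in_hom C (p j) P (X j)" by auto
  have k: "X k \<in> Obj C" using insert.prems by simp
  obtain q1 q2 where R: "is_product C P (X k) q1 q2" using C.product_exists[OF P k] .
  note q = C.product_hom[OF R]
  have MR: "is_product D (FObj M P) (FObj M (X k)) (FArr M q1) (FArr M q2)"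
    using M.preserves_product[OF M.pres_finite_limits R] .
  let ?p = "\<lambda>j. if j = k then q2 else p j \<cdot>\<^bsub>C\<^esub> q1"
  have ne: "j \<noteq> k" if "j \<in> S" for j using that insert.hyps by auto
  note A = q[unfolded in_hom_def]
  have "product_family (insert k S) X (Dom C q1) ?p"
    unfolding product_family_def
  proof (intro conjI allI impI ballI)
    show "Dom C q1 \<in> Obj C" using C.in_hom_Obj[OF q(1)] by simp
    show "in_hom C (?p j) (Dom C q1) (X j)" if "j \<in> insert k S" for j
      using that q p[of j] by (auto simp: in_hom_def)
  next
    fix T \<tau> assume T: "T \<in> Obj C \<and> (\<forall>j\<in>insert k S. in_hom C (\<tau> j) T (X j))"
    then have "\<exists>l. in_hom C l T P \<and> (\<forall>j\<in>S. p j \<cdot>\<^bsub>C\<^esub> l = \<tau> j)" using Q by simp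
    then obtain l where l: "in_hom C l T P" "\<And>j. j \<in> S \<Longrightarrow> p j \<cdot>\<^bsub>C\<^esub> l = \<tau> j" by blast
    obtain m where m: "in_hom C m T (Dom C q1)" "q1 \<cdot>\<^bsub>C\<^esub> m = l" "q2 \<cdot>\<^bsub>C\<^esub> m = \<tau> k"
      using C.product_lift[OF R l(1), of "\<tau> k"] T by auto
    have "?p j \<cdot>\<^bsub>C\<^esub> m = \<tau> j" if "j \<in> insert k S" for j
      using that m l p[of j] A ne[of j] by (auto simp: in_hom_def)
    then show "\<exists>l. in_hom C l T (Dom C q1) \<and> (\<forall>j\<in>insert k S. ?p j \<cdot>\<^bsub>C\<^esub> l = \<tau> j)"
      using m(1) by blast
  next
    fix T g g'
    assume *: "in_hom D g T (FObj M (Dom C q1)) \<and> in_hom D g' T (FObj M (Dom C q1)) \<and>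
      (\<forall>j\<in>insert k S. FArr M (?p j) \<cdot>\<^bsub>D\<^esub> g = FArr M (?p j) \<cdot>\<^bsub>D\<^esub> g')"
    have "FArr M (p j) \<cdot>\<^bsub>D\<^esub> (FArr M q1 \<cdot>\<^bsub>D\<^esub> g) = FArr M (p j) \<cdot>\<^bsub>D\<^esub> (FArr M q1 \<cdot>\<^bsub>D\<^esub> g')"
      if "j \<in> S" for j
    proof -
      have "FArr M (p j \<cdot>\<^bsub>C\<^esub> q1) \<cdot>\<^bsub>D\<^esub> g = FArr M (p j \<cdot>\<^bsub>C\<^esub> q1) \<cdot>\<^bsub>D\<^esub> g'"
        using * that ne[OF that] by auto
      then show ?thesis using * p[OF that] A by (simp add: in_hom_def)
    qed
    moreover have "in_hom D (FArr M q1 \<cdot>\<^bsub>D\<^esub> g) T (FObj M P)" "in_hom D (FArr M q1 \<cdot>\<^bsub>D\<^esub> g') T (FObj M P)"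
      using * A by (auto simp: in_hom_def)
    ultimately have "FArr M q1 \<cdot>\<^bsub>D\<^esub> g = FArr M q1 \<cdot>\<^bsub>D\<^esub> g'" using Q by blast
    moreover have "FArr M q2 \<cdot>\<^bsub>D\<^esub> g = FArr M q2 \<cdot>\<^bsub>D\<^esub> g'" using * by auto
    ultimately show "g = g'"
      by (intro D.product_ext[OF MR, of g T g']) (use * A in auto)
  next
    fix T \<tau> assume T: "T \<in> Obj D \<and> (\<forall>j\<in>insert k S. in_hom D (\<tau> j) T (N (X j)))"
    then have "\<exists>l. in_hom D l T (N P) \<and> (\<forall>j\<in>S. h (p j) \<cdot>\<^bsub>D\<^esub> l = \<tau> j)" using Q by simp
    then obtain l where l: "in_hom D l T (N P)" "\<And>j. j \<in> S \<Longrightarrow> h (p j) \<cdot>\<^bsub>D\<^esub> l = \<tau> j" by blast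
    obtain m where m: "in_hom D m T (N (Dom C q1))" "h q1 \<cdot>\<^bsub>D\<^esub> m = l" "h q2 \<cdot>\<^bsub>D\<^esub> m = \<tau> k"
      using preserves_products_lift[OF PP R l(1), of "\<tau> k"] T by auto
    have "h (?p j) \<cdot>\<^bsub>D\<^esub> m = \<tau> j" if "j \<in> insert k S" for j
      using that m l p[of j] A ne[of j] N.FArr_Comp'[of q1 "p j"] by (auto simp: in_hom_def)
    then show "\<exists>l. in_hom D l T (N (Dom C q1)) \<and> (\<forall>j\<in>insert k S. h (?p j) \<cdot>\<^bsub>D\<^esub> l = \<tau> j)"
      using m(1) by blast
  qed
  then show ?case by blast
qed

text \<open>
  A cone \<open>\<tau>\<close> over the \<open>N\<close>-image of a diagram gives an arrow to \<open>M L\<close>, by composing with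
  \<open>\<alpha>\<close>, and one to \<open>N P\<close>, where \<open>P\<close> is the product of the vertices. They agree in \<open>M P\<close>.
  As \<open>L \<rightarrow> P\<close> is monic, elementarity makes \<open>N L\<close> the pullback of \<open>M L\<close> and \<open>N P\<close>, so
  the two arrows combine to one into \<open>N L\<close>.
\<close>

lemma elementary_imp_preserves_limits:
  assumes E: "elementary C D NF M \<alpha>" and PP: "preserves_finite_products C D M N \<alpha>"
  shows "preserves_finite_limits C D NF"
  unfolding preserves_finite_limits_def
proof (intro allI impI)
  fix J :: "(nat, nat) cat" and F :: "(nat, nat, 'o, 'm) ftor" and L \<pi>
  assume *: "finite (Obj J) \<and> finite (Arr J) \<and> is_functor J C F \<and> is_limit J C F L \<pi>"
  then interpret F: is_functor J C F by simp
  have lim: "is_limit J C F L \<pi>" using * by simp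
  then have L: "L \<in> Obj C" and \<pi>: "\<And>j. j \<in> Obj J \<Longrightarrow> in_hom C (\<pi> j) L (FObj F j)"
    and F\<pi>: "\<And>g. g \<in> Arr J \<Longrightarrow> FArr F g \<cdot>\<^bsub>C\<^esub> \<pi> (Dom J g) = \<pi> (Cod J g)"
    by (auto simp: is_limit_def is_cone_def)
  have MM: "preserves_finite_limits C D M" by (rule M.pres_finite_limits)
  have Mlim: "is_limit J D (ftor_comp M F) (FObj M L) (\<lambda>j. FArr M (\<pi> j))"
    using MM[unfolded preserves_finite_limits_def, rule_format, of J F L \<pi>] * by simp
  obtain P p where pf: "product_family (Obj J) (FObj F) P p"
    using product_family_exists[OF PP, of "Obj J" "FObj F"] * F.FObj_Obj by blast
  have P: "P \<in> Obj C" and p: "\<And>j. j \<in> Obj J \<Longrightarrow> in_hom C (p j) P (FObj F j)"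
    using pf by (auto simp: product_family_def)
  have Cl: "\<exists>l. in_hom C l T P \<and> (\<forall>j\<in>Obj J. p j \<cdot>\<^bsub>C\<^esub> l = \<tau> j)"
    if "T \<in> Obj C" "\<forall>j\<in>Obj J. in_hom C (\<tau> j) T (FObj F j)" for T \<tau>
    using pf that unfolding product_family_def by blast
  have Mj: "g = g'"
    if "in_hom D g T (FObj M P)" "in_hom D g' T (FObj M P)"
      "\<forall>j\<in>Obj J. FArr M (p j) \<cdot>\<^bsub>D\<^esub> g = FArr M (p j) \<cdot>\<^bsub>D\<^esub> g'" for T g g'
    using pf that unfolding product_family_def by blast
  have Nl: "\<exists>l. in_hom D l T (N P) \<and> (\<forall>j\<in>Obj J. h (p j) \<cdot>\<^bsub>D\<^esub> l = \<tau> j)"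
    if "T \<in> Obj D" "\<forall>j\<in>Obj J. in_hom D (\<tau> j) T (N (FObj F j))" for T \<tau>
    using pf that unfolding product_family_def by blast
  obtain i where i: "in_hom C i L P" "\<And>j. j \<in> Obj J \<Longrightarrow> p j \<cdot>\<^bsub>C\<^esub> i = \<pi> j"
    using Cl[OF L, of \<pi>] \<pi> by blast
  have mono_i: "mono_arr C i"
    unfolding mono_arr_def
  proof (intro conjI allI impI)
    show "i \<in> Arr C" using i by (simp add: in_hom_def)
    fix t g g'
    assume "in_hom C g t (Dom C i) \<and> in_hom C g' t (Dom C i) \<and> i \<cdot>\<^bsub>C\<^esub> g = i \<cdot>\<^bsub>C\<^esub> g'"
    then have g: "in_hom C g t L" "in_hom C g' t L" and eq: "i \<cdot>\<^bsub>C\<^esub> g = i \<cdot>\<^bsub>C\<^esub> g'"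
      using i by (auto simp: in_hom_def)
    have \<pi>g: "\<pi> j \<cdot>\<^bsub>C\<^esub> g = \<pi> j \<cdot>\<^bsub>C\<^esub> g'" if j: "j \<in> Obj J" for j
      using g eq i(1) p[OF j] by (simp add: in_hom_def C.extend_eq[OF i(2)[OF j], symmetric])
    have "FArr F f \<cdot>\<^bsub>C\<^esub> (\<pi> (Dom J f) \<cdot>\<^bsub>C\<^esub> g) = \<pi> (Cod J f) \<cdot>\<^bsub>C\<^esub> g" if "f \<in> Arr J" for f
      using that g \<pi>[OF F.C.Dom_Obj[OF that]] C.extend_eq[OF F\<pi>[OF that], of g] by (simp add: in_hom_def)
    then have "is_cone J C F t (\<lambda>j. \<pi> j \<cdot>\<^bsub>C\<^esub> g)"
      using C.in_hom_Obj[OF g(1)] g \<pi> by (simp add: is_cone_def in_hom_def)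
    then have "\<exists>!u. in_hom C u t L \<and> (\<forall>j\<in>Obj J. \<pi> j \<cdot>\<^bsub>C\<^esub> u = \<pi> j \<cdot>\<^bsub>C\<^esub> g)"
      using lim unfolding is_limit_def by blast
    then show "g = g'" using g \<pi>g by (metis (no_types, lifting))
  qed
  have NPB: "is_pullback D (FArr M i) (\<alpha> P) (\<alpha> L) (h i)"
    by (rule elementary_pullback[OF E mono_i i(1)])
  have Npi: "in_hom D (h (\<pi> j)) (N L) (N (FObj F j))" if "j \<in> Obj J" for j
    using \<pi>[OF that] by (simp add: in_hom_def)
  have "is_limit J D (ftor_comp NF F) (N L) (\<lambda>j. h (\<pi> j))"
    unfolding is_limit_def
  proof (intro conjI allI impI)
    have "h (FArr F g) \<cdot>\<^bsub>D\<^esub> h (\<pi> (Dom J g)) = h (\<pi> (Cod J g))" if "g \<in> Arr J" for g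
      using N.FArr_Comp'[of "\<pi> (Dom J g)" "FArr F g"] F\<pi>[OF that] \<pi>[OF F.C.Dom_Obj[OF that]] that
      by (simp add: in_hom_def)
    then show "is_cone J D (ftor_comp NF F) (N L) (\<lambda>j. h (\<pi> j))"
      using Npi L by (simp add: is_cone_def ftor_comp_def)
    fix T \<tau>
    assume "is_cone J D (ftor_comp NF F) T \<tau>"
    then have T: "T \<in> Obj D" and \<tau>: "\<And>j. j \<in> Obj J \<Longrightarrow> in_hom D (\<tau> j) T (N (FObj F j))"
      and F\<tau>: "\<And>g. g \<in> Arr J \<Longrightarrow> h (FArr F g) \<cdot>\<^bsub>D\<^esub> \<tau> (Dom J g) = \<tau> (Cod J g)"
      by (auto simp: is_cone_def ftor_comp_def)
    let ?\<sigma> = "\<lambda>j. \<alpha> (FObj F j) \<cdot>\<^bsub>D\<^esub> \<tau> j"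
    have "FArr M (FArr F g) \<cdot>\<^bsub>D\<^esub> ?\<sigma> (Dom J g) = ?\<sigma> (Cod J g)" if g: "g \<in> Arr J" for g
    proof -
      have Fg: "in_hom C (FArr F g) (FObj F (Dom J g)) (FObj F (Cod J g))" using g by (simp add: in_hom_def)
      have O: "FObj F (Dom J g) \<in> Obj C" "FObj F (Cod J g) \<in> Obj C" using C.in_hom_Obj[OF Fg] by auto
      show ?thesis
        using D.extend_eq[OF natural[OF Fg], of "\<tau> (Dom J g)"] \<tau>[OF F.C.Dom_Obj[OF g]] F\<tau>[OF g] O g
        by (simp add: in_hom_def)
    qed
    then have "is_cone J D (ftor_comp M F) T ?\<sigma>"
      using T \<tau> F.FObj_Obj by (simp add: is_cone_def ftor_comp_def in_hom_def)
    then have ex1: "\<exists>!m. in_hom D m T (FObj M L) \<and> (\<forall>j\<in>Obj J. FArr M (\<pi> j) \<cdot>\<^bsub>D\<^esub> m = ?\<sigma> j)"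
      using Mlim unfolding is_limit_def by blast
    then obtain m where m: "in_hom D m T (FObj M L)" "\<And>j. j \<in> Obj J \<Longrightarrow> FArr M (\<pi> j) \<cdot>\<^bsub>D\<^esub> m = ?\<sigma> j"
      by blast
    have m_uniq: "m' = m" if "in_hom D m' T (FObj M L)" "\<forall>j\<in>Obj J. FArr M (\<pi> j) \<cdot>\<^bsub>D\<^esub> m' = ?\<sigma> j" for m'
      using ex1 m that by blast
    obtain u where u: "in_hom D u T (N P)" "\<And>j. j \<in> Obj J \<Longrightarrow> h (p j) \<cdot>\<^bsub>D\<^esub> u = \<tau> j"
      using Nl[OF T, of \<tau>] \<tau> by blast
    have "FArr M i \<cdot>\<^bsub>D\<^esub> m = \<alpha> P \<cdot>\<^bsub>D\<^esub> u"
    proof (rule Mj[of _ T], goal_cases)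
      case 3
      have "FArr M (p j) \<cdot>\<^bsub>D\<^esub> (FArr M i \<cdot>\<^bsub>D\<^esub> m) = FArr M (p j) \<cdot>\<^bsub>D\<^esub> (\<alpha> P \<cdot>\<^bsub>D\<^esub> u)"
        if j: "j \<in> Obj J" for j
      proof -
        have "FArr M (p j) \<cdot>\<^bsub>D\<^esub> FArr M i = FArr M (\<pi> j)"
          using M.FArr_Comp'[of i "p j"] i p[OF j] j by (simp add: in_hom_def)
        from D.extend_eq[OF this, of m]
        have 1: "FArr M (p j) \<cdot>\<^bsub>D\<^esub> (FArr M i \<cdot>\<^bsub>D\<^esub> m) = ?\<sigma> j"
          using m i p[OF j] j by (simp add: in_hom_def)
        have "FObj F j \<in> Obj C" using F.FObj_Obj j by simp
        then have 2: "FArr M (p j) \<cdot>\<^bsub>D\<^esub> (\<alpha> P \<cdot>\<^bsub>D\<^esub> u) = ?\<sigma> j"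
          using D.extend_eq[OF natural[OF p[OF j], symmetric], of u] u p[OF j] j P by (simp add: in_hom_def)
        show ?thesis using 1 2 by simp
      qed
      then show ?case by blast
    qed (use m i u P in \<open>simp_all add: in_hom_def\<close>)
    then obtain k where k: "in_hom D k T (N L)" "\<alpha> L \<cdot>\<^bsub>D\<^esub> k = m"
      by (rule D.pullback_lift[OF NPB, of m T u, rotated 2])
        (use m u i P L in \<open>simp_all add: in_hom_def\<close>)
    have \<alpha>N: "\<alpha> (FObj F j) \<cdot>\<^bsub>D\<^esub> (h (\<pi> j) \<cdot>\<^bsub>D\<^esub> k') = FArr M (\<pi> j) \<cdot>\<^bsub>D\<^esub> (\<alpha> L \<cdot>\<^bsub>D\<^esub> k')"
      if "in_hom D k' T (N L)" "j \<in> Obj J" for k' j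
      using D.extend_eq[OF natural[OF \<pi>[OF that(2)]], of k'] that \<pi>[OF that(2)] L F.FObj_Obj[OF that(2)]
      by (simp add: in_hom_def)
    show "\<exists>!k. in_hom D k T (N L) \<and> (\<forall>j\<in>Obj J. h (\<pi> j) \<cdot>\<^bsub>D\<^esub> k = \<tau> j)"
    proof (rule ex1I[of _ k])
      have "h (\<pi> j) \<cdot>\<^bsub>D\<^esub> k = \<tau> j" if j: "j \<in> Obj J" for j
        by (rule alpha_cancel[OF F.FObj_Obj[OF j], of _ T])
          (use \<alpha>N[OF k(1) j] k m(2)[OF j] \<tau>[OF j] Npi[OF j] in \<open>simp_all add: in_hom_def\<close>)
      then show "in_hom D k T (N L) \<and> (\<forall>j\<in>Obj J. h (\<pi> j) \<cdot>\<^bsub>D\<^esub> k = \<tau> j)" using k by blast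
      fix k' assume k': "in_hom D k' T (N L) \<and> (\<forall>j\<in>Obj J. h (\<pi> j) \<cdot>\<^bsub>D\<^esub> k' = \<tau> j)"
      have "\<alpha> L \<cdot>\<^bsub>D\<^esub> k' = m"
      proof (rule m_uniq)
        show "in_hom D (\<alpha> L \<cdot>\<^bsub>D\<^esub> k') T (FObj M L)" using k' L by (simp add: in_hom_def)
        show "\<forall>j\<in>Obj J. FArr M (\<pi> j) \<cdot>\<^bsub>D\<^esub> (\<alpha> L \<cdot>\<^bsub>D\<^esub> k') = ?\<sigma> j"
          using \<alpha>N k' by metis
      qed
      then show "k' = k" using alpha_cancel[OF L] k k' by blast
    qed
  qed
  then show "is_limit J D (ftor_comp NF F) (FObj NF L) (\<lambda>j. FArr NF (\<pi> j))" by simp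
qed

section \<open>Coherent elementary subfunctors satisfy the criterion\<close>

lemma preserves_limits_imp_preserves_products:
  assumes PL: "preserves_finite_limits C D NF"
  shows "preserves_finite_products C D M N \<alpha>"
  unfolding preserves_finite_products_def
proof (intro conjI allI impI ballI)
  fix t assume t: "is_terminal C t"
  have O: "t \<in> Obj C" using t by (simp add: is_terminal_def)
  have Mt: "is_terminal D (FObj M t)" and Nt: "is_terminal D (N t)"
    using M.preserves_terminal[OF M.pres_finite_limits t] N.preserves_terminal[OF PL t] by auto
  then obtain \<beta> where \<beta>: "in_hom D \<beta> (FObj M t) (N t)" unfolding is_terminal_def by blast
  have "in_hom D (\<beta> \<cdot>\<^bsub>D\<^esub> \<alpha> t) (N t) (N t)" "in_hom D (\<alpha> t \<cdot>\<^bsub>D\<^esub> \<beta>) (FObj M t) (FObj M t)"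
    using \<beta> O by (auto simp: in_hom_def)
  then have "\<beta> \<cdot>\<^bsub>D\<^esub> \<alpha> t = Ident D (N t)" "\<alpha> t \<cdot>\<^bsub>D\<^esub> \<beta> = Ident D (FObj M t)"
    using Mt Nt D.Ident_in_hom unfolding is_terminal_def by blast+
  then show "iso_arr D (\<alpha> t)" using \<beta> O by (auto simp: iso_arr_def)
next
  fix x y p1 p2 t1 t2 s1 s2 a c
  assume O: "x \<in> Obj C" "y \<in> Obj C" and P: "is_product C x y p1 p2"
    and *: "is_product D (N x) (N y) t1 t2 \<and> is_product D (FObj M x) (FObj M y) s1 s2 \<and>
       is_product_arr D t1 t2 s1 s2 (\<alpha> x) (\<alpha> y) a \<and> in_hom D c (FObj M (Dom C p1)) (Dom D s1) \<and>
       s1 \<cdot>\<^bsub>D\<^esub> c = FArr M p1 \<and> s2 \<cdot>\<^bsub>D\<^esub> c = FArr M p2"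
  then have T: "is_product D (N x) (N y) t1 t2" and S: "is_product D (FObj M x) (FObj M y) s1 s2"
    and a: "in_hom D a (Dom D t1) (Dom D s1)" "s1 \<cdot>\<^bsub>D\<^esub> a = \<alpha> x \<cdot>\<^bsub>D\<^esub> t1" "s2 \<cdot>\<^bsub>D\<^esub> a = \<alpha> y \<cdot>\<^bsub>D\<^esub> t2"
    and c: "in_hom D c (FObj M (Dom C p1)) (Dom D s1)" "s1 \<cdot>\<^bsub>D\<^esub> c = FArr M p1" "s2 \<cdot>\<^bsub>D\<^esub> c = FArr M p2"
    by (auto simp: is_product_arr_def)
  note p = C.product_hom[OF P]
  have O': "Dom C p1 \<in> Obj C" using C.in_hom_Obj[OF p(1)] by simp
  have NP: "is_product D (N x) (N y) (h p1) (h p2)" using N.preserves_product[OF PL P] by simp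
  note A = O O' p[unfolded in_hom_def] D.product_hom[OF T, unfolded in_hom_def]
    D.product_hom[OF S, unfolded in_hom_def] a(1)[unfolded in_hom_def] c(1)[unfolded in_hom_def]
  have hp: "in_hom D (h p1) (N (Dom C p1)) (N x)" "in_hom D (h p2) (N (Dom C p1)) (N y)"
    "Dom D (h p1) = N (Dom C p1)"
    using A by (simp_all add: in_hom_def)
  obtain \<phi> where \<phi>: "in_hom D \<phi> (N (Dom C p1)) (Dom D t1)" "t1 \<cdot>\<^bsub>D\<^esub> \<phi> = h p1" "t2 \<cdot>\<^bsub>D\<^esub> \<phi> = h p2"
    using D.product_lift[OF T hp(1,2)] .
  obtain \<psi> where \<psi>: "in_hom D \<psi> (Dom D t1) (N (Dom C p1))" "h p1 \<cdot>\<^bsub>D\<^esub> \<psi> = t1" "h p2 \<cdot>\<^bsub>D\<^esub> \<psi> = t2"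
    using D.product_lift[OF NP D.product_hom[OF T]] hp(3) by auto
  note B = A \<phi>(1)[unfolded in_hom_def] \<psi>(1)[unfolded in_hom_def] hp[unfolded in_hom_def]
  have TO: "Dom D t1 \<in> Obj D" using D.in_hom_Obj[OF \<psi>(1)] by simp
  have "\<phi> \<cdot>\<^bsub>D\<^esub> \<psi> = Ident D (Dom D t1)"
    by (rule D.product_ext[OF T, of _ "Dom D t1"])
      (use B TO \<psi> D.extend_eq[OF \<phi>(2), of \<psi>] D.extend_eq[OF \<phi>(3), of \<psi>] in \<open>simp_all add: in_hom_def\<close>)
  moreover have "\<psi> \<cdot>\<^bsub>D\<^esub> \<phi> = Ident D (N (Dom C p1))"
    by (rule D.product_ext[OF NP, of _ "N (Dom C p1)"])
      (use B \<phi> D.extend_eq[OF \<psi>(2), of \<phi>] D.extend_eq[OF \<psi>(3), of \<phi>] in \<open>simp_all add: in_hom_def\<close>)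
  ultimately have "iso_arr D \<phi>" using \<phi>(1) \<psi>(1) by (auto simp: iso_arr_def in_hom_def)
  moreover have "a \<cdot>\<^bsub>D\<^esub> \<phi> = c \<cdot>\<^bsub>D\<^esub> \<alpha> (Dom C p1)"
  proof (rule D.product_ext[OF S, of _ "N (Dom C p1)"])
    show "s1 \<cdot>\<^bsub>D\<^esub> (a \<cdot>\<^bsub>D\<^esub> \<phi>) = s1 \<cdot>\<^bsub>D\<^esub> (c \<cdot>\<^bsub>D\<^esub> \<alpha> (Dom C p1))"
      using B D.extend_eq[OF a(2), of \<phi>] D.extend_eq[OF c(2), of "\<alpha> (Dom C p1)"] \<phi>(2) natural[OF p(1)]
      by simp
    show "s2 \<cdot>\<^bsub>D\<^esub> (a \<cdot>\<^bsub>D\<^esub> \<phi>) = s2 \<cdot>\<^bsub>D\<^esub> (c \<cdot>\<^bsub>D\<^esub> \<alpha> (Dom C p1))"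
      using B D.extend_eq[OF a(3), of \<phi>] D.extend_eq[OF c(3), of "\<alpha> (Dom C p1)"] \<phi>(3) natural[OF p(2)]
      by simp
  qed (use B in \<open>simp_all add: in_hom_def\<close>)
  ultimately show "\<exists>\<phi>. iso_arr D \<phi> \<and> in_hom D \<phi> (N (Dom C p1)) (Dom D t1) \<and> a \<cdot>\<^bsub>D\<^esub> \<phi> = c \<cdot>\<^bsub>D\<^esub> \<alpha> (Dom C p1)"
    using \<phi>(1) by blast
qed

text \<open>
  Let \<open>m \<cdot> e\<close> be the image factorization of \<open>p2 \<cdot> i\<close> in \<open>C\<close>, and \<open>c\<close> the middle object.
  Elementarity for \<open>i\<close> identifies \<open>q\<close> with \<open>N\<close> of the domain of \<open>i\<close>, and elementarity
  for \<open>m\<close> lets \<open>s \<rightarrow> N y\<close> factor through \<open>N c\<close>. Hence the image \<open>p\<close> of \<open>s\<close> is a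
  subobject \<open>d\<close> of \<open>N c\<close>, and \<open>d\<close> composed with \<open>q \<rightarrow> p\<close> is, up to the identification of
  \<open>q\<close>, the effective epimorphism \<open>N e\<close>.
\<close>

lemma coherent_elementary_imp_tarski_vaught:
  assumes E: "elementary C D NF M \<alpha>" and PP: "preserves_finite_products C D M N \<alpha>"
    and epi: "\<And>e. effective_epi C e \<Longrightarrow> effective_epi D (h e)"
  shows "tarski_vaught C D M N \<alpha>"
  unfolding tarski_vaught_def
proof (intro ballI allI impI)
  fix x y p1 p2 i r1 r2 u t1 t2 v sm sn qm qn j f k
  assume O: "x \<in> Obj C" "y \<in> Obj C"
    and *: "is_product C x y p1 p2 \<and> mono_arr C i \<and> Cod C i = Dom C p1"
    and **: "is_product D (FObj M x) (N y) r1 r2 \<and>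
       is_product_arr D r1 r2 (FArr M p1) (FArr M p2) (Ident D (FObj M x)) (\<alpha> y) u \<and>
       is_product D (N x) (N y) t1 t2 \<and>
       is_product_arr D t1 t2 (FArr M p1) (FArr M p2) (\<alpha> x) (\<alpha> y) v \<and>
       is_pullback D (FArr M i) u sm sn \<and> is_pullback D (FArr M i) v qm qn \<and>
       in_hom D j (Dom D qm) (Dom D sm) \<and> sm \<cdot>\<^bsub>D\<^esub> j = qm \<and>
       is_image_factorization D (r2 \<cdot>\<^bsub>D\<^esub> sn) f k"
  have P: "is_product C x y p1 p2" and mi: "mono_arr C i" using * by auto
  have R: "is_product D (FObj M x) (N y) r1 r2" and T: "is_product D (N x) (N y) t1 t2"
    and S: "is_pullback D (FArr M i) u sm sn" and Q: "is_pullback D (FArr M i) v qm qn"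
    and j: "in_hom D j (Dom D qm) (Dom D sm)" "sm \<cdot>\<^bsub>D\<^esub> j = qm"
    and im: "effective_epi D f" "mono_arr D k" "Cod D f = Dom D k" "k \<cdot>\<^bsub>D\<^esub> f = r2 \<cdot>\<^bsub>D\<^esub> sn"
    using ** by (auto simp: is_image_factorization_def)
  let ?P = "Dom C p1" and ?z = "Dom C i" and ?q = "Dom D qm" and ?s = "Dom D sm"
  have u: "in_hom D u (Dom D r1) (FObj M ?P)" "FArr M p2 \<cdot>\<^bsub>D\<^esub> u = \<alpha> y \<cdot>\<^bsub>D\<^esub> r2"
    and v: "in_hom D v (Dom D t1) (FObj M ?P)" "FArr M p1 \<cdot>\<^bsub>D\<^esub> v = \<alpha> x \<cdot>\<^bsub>D\<^esub> t1"
      "FArr M p2 \<cdot>\<^bsub>D\<^esub> v = \<alpha> y \<cdot>\<^bsub>D\<^esub> t2"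
    using ** C.product_hom[OF P] by (auto simp: is_product_arr_def in_hom_def)
  have MP: "is_product D (FObj M x) (FObj M y) (FArr M p1) (FArr M p2)"
    using M.preserves_product[OF M.pres_finite_limits P] .
  note p = C.product_hom[OF P]
  have i: "in_hom C i ?z ?P" using * C.mono_arr_Arr by (auto simp: in_hom_def)
  have O': "?P \<in> Obj C" "?z \<in> Obj C" using C.in_hom_Obj[OF i] by auto
  have kA: "k \<in> Arr D" "f \<in> Arr D" using im D.mono_arr_Arr D.effective_epi_Arr by auto
  note A = O O' p[unfolded in_hom_def] i[unfolded in_hom_def] u(1)[unfolded in_hom_def]
    v(1)[unfolded in_hom_def] D.product_hom[OF R, unfolded in_hom_def]
    D.product_hom[OF T, unfolded in_hom_def] j(1)[unfolded in_hom_def] kA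
  have sm: "in_hom D sm ?s (FObj M ?z)" "in_hom D sn ?s (Dom D r1)" "FArr M i \<cdot>\<^bsub>D\<^esub> sm = u \<cdot>\<^bsub>D\<^esub> sn"
    and qm: "in_hom D qm ?q (FObj M ?z)" "in_hom D qn ?q (Dom D t1)" "FArr M i \<cdot>\<^bsub>D\<^esub> qm = v \<cdot>\<^bsub>D\<^esub> qn"
    using D.pullback_hom[OF S] D.pullback_hom[OF Q] A by (auto simp: in_hom_def)
  note B = A sm(1,2)[unfolded in_hom_def] qm(1,2)[unfolded in_hom_def]

  \<comment> \<open>The comparison \<open>\<theta>\<close> of \<open>q\<close> with \<open>N\<close> of the domain of \<open>i\<close>, and its inverse.\<close>
  obtain w where w: "in_hom D w ?q (N ?P)" "h p1 \<cdot>\<^bsub>D\<^esub> w = t1 \<cdot>\<^bsub>D\<^esub> qn" "h p2 \<cdot>\<^bsub>D\<^esub> w = t2 \<cdot>\<^bsub>D\<^esub> qn"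
    by (rule preserves_products_lift[OF PP P, of "t1 \<cdot>\<^bsub>D\<^esub> qn" ?q "t2 \<cdot>\<^bsub>D\<^esub> qn"])
      (use B in \<open>simp_all add: in_hom_def\<close>)
  note n1 = natural[OF p(1)] and n2 = natural[OF p(2)]
  have "FArr M i \<cdot>\<^bsub>D\<^esub> qm = \<alpha> ?P \<cdot>\<^bsub>D\<^esub> w"
    unfolding qm(3)
    by (rule D.product_ext[OF MP, of _ ?q])
      (use B w D.extend_eq[OF n1[symmetric], of w] D.extend_eq[OF n2[symmetric], of w]
        D.extend_eq[OF v(2), of qn] D.extend_eq[OF v(3), of qn] in \<open>simp_all add: in_hom_def\<close>)
  then obtain \<theta> where \<theta>: "in_hom D \<theta> ?q (N ?z)" "\<alpha> ?z \<cdot>\<^bsub>D\<^esub> \<theta> = qm"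
    by (rule D.pullback_lift[OF elementary_pullback[OF E mi i], of qm ?q w, rotated 2])
      (use B w in \<open>simp_all add: in_hom_def\<close>)
  obtain b where b: "in_hom D b (N ?z) (Dom D t1)" "t1 \<cdot>\<^bsub>D\<^esub> b = h p1 \<cdot>\<^bsub>D\<^esub> h i" "t2 \<cdot>\<^bsub>D\<^esub> b = h p2 \<cdot>\<^bsub>D\<^esub> h i"
    by (rule D.product_lift[OF T, of "h p1 \<cdot>\<^bsub>D\<^esub> h i" "N ?z" "h p2 \<cdot>\<^bsub>D\<^esub> h i"])
      (use B in \<open>simp_all add: in_hom_def\<close>)
  have "FArr M i \<cdot>\<^bsub>D\<^esub> \<alpha> ?z = v \<cdot>\<^bsub>D\<^esub> b"
    unfolding natural[OF i, symmetric]
    by (rule D.product_ext[OF MP, of _ "N ?z"])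
      (use B b D.extend_eq[OF n1[symmetric], of "h i"] D.extend_eq[OF n2[symmetric], of "h i"]
        D.extend_eq[OF v(2), of b] D.extend_eq[OF v(3), of b] in \<open>simp_all add: in_hom_def\<close>)
  then obtain \<theta>' where \<theta>': "in_hom D \<theta>' (N ?z) ?q" "qm \<cdot>\<^bsub>D\<^esub> \<theta>' = \<alpha> ?z"
    by (rule D.pullback_lift[OF Q, of "\<alpha> ?z" "N ?z" b, rotated 2])
      (use B b in \<open>simp_all add: in_hom_def\<close>)
  have \<theta>\<theta>': "\<theta> \<cdot>\<^bsub>D\<^esub> \<theta>' = Ident D (N ?z)"
    by (rule alpha_cancel[OF O'(2), of _ "N ?z"])
      (use B \<theta> \<theta>' D.extend_eq[OF \<theta>(2), of \<theta>'] in \<open>simp_all add: in_hom_def\<close>)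
  have "mono_arr D v"
  proof (rule D.product_arr_mono[OF T, of "\<alpha> x" "\<alpha> y"])
    show "is_product_arr D t1 t2 (FArr M p1) (FArr M p2) (\<alpha> x) (\<alpha> y) v" using ** by blast
  qed (use B in \<open>simp_all add: in_hom_def\<close>)
  then have mono_qm: "mono_arr D qm" by (rule D.pullback_mono[OF Q])
  have qO: "?q \<in> Obj D" using D.in_hom_Obj[OF \<theta>(1)] by simp
  have "\<theta>' \<cdot>\<^bsub>D\<^esub> \<theta> = Ident D ?q"
    by (rule D.mono_arrD[OF mono_qm, of _ ?q])
      (use B qO \<theta> \<theta>' D.extend_eq[OF \<theta>'(2), of \<theta>] in \<open>simp_all add: in_hom_def\<close>)
  then have \<theta>_iso: "iso_arr D \<theta>"
    using \<theta>\<theta>' \<theta>(1) \<theta>'(1) unfolding iso_arr_def in_hom_def by auto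
  have "p2 \<cdot>\<^bsub>C\<^esub> i \<in> Arr C" using B by simp
  then obtain e m where "is_image_factorization C (p2 \<cdot>\<^bsub>C\<^esub> i) e m"
    using C.factorizations by blast
  then have e: "effective_epi C e" and m: "mono_arr C m" and em: "Cod C e = Dom C m" "m \<cdot>\<^bsub>C\<^esub> e = p2 \<cdot>\<^bsub>C\<^esub> i"
    by (auto simp: is_image_factorization_def)
  let ?c = "Dom C m"
  have eA: "e \<in> Arr C" "m \<in> Arr C" using C.effective_epi_Arr[OF e] C.mono_arr_Arr[OF m] by auto
  have "Dom C e = ?z" "Cod C m = y"
    using arg_cong[OF em(2), of "Dom C"] arg_cong[OF em(2), of "Cod C"] eA em(1) B by simp_all
  then have eh: "in_hom C e ?z ?c" and mh: "in_hom C m ?c y" using eA em(1) by (auto simp: in_hom_def)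
  have cO: "?c \<in> Obj C" using C.in_hom_Obj[OF mh] by simp
  have Mem: "FArr M m \<cdot>\<^bsub>D\<^esub> FArr M e = FArr M p2 \<cdot>\<^bsub>D\<^esub> FArr M i"
    using M.FArr_Comp'[of e m] M.FArr_Comp'[of i p2] em eA B by simp
  note B = B eh[unfolded in_hom_def] mh[unfolded in_hom_def] cO \<theta>(1)[unfolded in_hom_def]
  have "FArr M m \<cdot>\<^bsub>D\<^esub> (FArr M e \<cdot>\<^bsub>D\<^esub> sm) = \<alpha> y \<cdot>\<^bsub>D\<^esub> (r2 \<cdot>\<^bsub>D\<^esub> sn)"
    using B D.extend_eq[OF Mem, of sm] sm(3) D.extend_eq[OF u(2), of sn] by simp
  then obtain g where g: "in_hom D g ?s (N ?c)" "\<alpha> ?c \<cdot>\<^bsub>D\<^esub> g = FArr M e \<cdot>\<^bsub>D\<^esub> sm" "h m \<cdot>\<^bsub>D\<^esub> g = r2 \<cdot>\<^bsub>D\<^esub> sn"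
    by (rule D.pullback_lift[OF elementary_pullback[OF E m mh], of "FArr M e \<cdot>\<^bsub>D\<^esub> sm" ?s "r2 \<cdot>\<^bsub>D\<^esub> sn", rotated 2])
      (use B in \<open>simp_all add: in_hom_def\<close>)
  have fk: "Dom D f = ?s" "Cod D k = N y"
    using arg_cong[OF im(4), of "Dom D"] arg_cong[OF im(4), of "Cod D"] im(3) B by simp_all
  obtain d where d: "in_hom D d (Cod D f) (N ?c)" "d \<cdot>\<^bsub>D\<^esub> f = g" "h m \<cdot>\<^bsub>D\<^esub> d = k"
    by (rule D.effective_epi_diagonal[OF im(1) h_mono[OF m], of g k])
      (use B fk im g in \<open>simp_all add: in_hom_def\<close>)
  have mono_d: "mono_arr D d"
    by (rule D.mono_arr_cancel[of "h m"]) (use B d im(2) in \<open>simp_all add: in_hom_def\<close>)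
  have "g \<cdot>\<^bsub>D\<^esub> j = h e \<cdot>\<^bsub>D\<^esub> \<theta>"
    by (rule alpha_cancel[OF cO, of _ ?q])
      (use B g(1) j(2) \<theta>(2) D.extend_eq[OF g(2), of j] D.extend_eq[OF natural[OF eh], of \<theta>]
        in \<open>simp_all add: in_hom_def\<close>)
  then have "d \<cdot>\<^bsub>D\<^esub> (f \<cdot>\<^bsub>D\<^esub> j) = h e \<cdot>\<^bsub>D\<^esub> \<theta>"
    using D.extend_eq[OF d(2), of j] d(1) B fk by (simp add: in_hom_def)
  moreover have "effective_epi D (h e \<cdot>\<^bsub>D\<^esub> \<theta>)"
    by (rule D.effective_epi_Comp_iso[OF epi[OF e] \<theta>_iso]) (use B in simp)
  ultimately have "effective_epi D (d \<cdot>\<^bsub>D\<^esub> (f \<cdot>\<^bsub>D\<^esub> j))" by simp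
  then show "effective_epi D (f \<cdot>\<^bsub>D\<^esub> j)"
    by (rule D.effective_epi_of_mono_Comp[OF _ mono_d]) (use B d(1) fk in \<open>simp_all add: in_hom_def\<close>)
qed

end


section \<open>Characterization of coherent elementary subfunctors\<close>

theorem theorem3p8:
  fixes C :: "('o, 'm) cat" and D :: "('p, 'n) cat"
    and M :: "('o, 'm, 'p, 'n) ftor"
    and N :: "'o \<Rightarrow> 'p" and \<alpha> :: "'o \<Rightarrow> 'n"
  assumes "coherent_category C" and "coherent_category D"
    and "coherent_functor C D M"
    and "\<And>x. x \<in> Obj C \<Longrightarrow> mono_arr D (\<alpha> x) \<and> in_hom D (\<alpha> x) (N x) (FObj M x)"
  shows "(tarski_vaught C D M N \<alpha> \<and> preserves_finite_products C D M N \<alpha>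
            \<longleftrightarrow> extends_to_coherent_elementary C D M N \<alpha>) \<and>
         (tarski_vaught C D M N \<alpha> \<and> preserves_finite_products C D M N \<alpha>
            \<longleftrightarrow> uniquely_extends_to_coherent_elementary C D M N \<alpha>)"
proof -
  interpret subobject_family C D M N \<alpha>
    using assms by (intro subobject_family.intro subobject_family_axioms.intro)
  have unique: "uniquely_extends_to_coherent_elementary C D M N \<alpha>"
    if TV: "tarski_vaught C D M N \<alpha>" and PP: "preserves_finite_products C D M N \<alpha>"
  proof -
    obtain h where ext: "functorial_extension C D M N \<alpha> h"
      using functorial_extension_exists[OF TV] .
    interpret natural_subfamily C D M N \<alpha> h
      using ext by unfold_locales
    have E: "elementary C D NF M \<alpha>"
      using tarski_vaught_imp_elementary[OF TV] .
    have "coherent_functor C D NF"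
    proof (unfold_locales, goal_cases)
      case 1 show ?case using elementary_imp_preserves_limits[OF E PP] .
    next
      case (2 A x u) then show ?case using elementary_imp_preserves_unions[OF E] by simp
    next
      case (3 e) then show ?case using tarski_vaught_imp_effective_epi[OF TV] by simp
    qed
    then show ?thesis
      unfolding uniquely_extends_to_coherent_elementary_def
      using ext E functorial_extension_unique[OF ext] by blast
  qed
  have criterion: "tarski_vaught C D M N \<alpha> \<and> preserves_finite_products C D M N \<alpha>"
    if extends: "extends_to_coherent_elementary C D M N \<alpha>"
  proof -
    obtain h where ext: "functorial_extension C D M N \<alpha> h"
      and coh: "coherent_functor C D \<lparr>FObj = N, FArr = h\<rparr>"
      and E: "elementary C D \<lparr>FObj = N, FArr = h\<rparr> M \<alpha>"
      using extends unfolding extends_to_coherent_elementary_def by blast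
    interpret natural_subfamily C D M N \<alpha> h
      using ext by unfold_locales
    have PP: "preserves_finite_products C D M N \<alpha>"
      using preserves_limits_imp_preserves_products coherent_functor.pres_finite_limits[OF coh] .
    have "effective_epi D (h e)" if "effective_epi C e" for e
      using coherent_functor.pres_effective_epi[OF coh that] by simp
    then show ?thesis
      using coherent_elementary_imp_tarski_vaught[OF E PP] PP by blast
  qed
  have "extends_to_coherent_elementary C D M N \<alpha>" if "uniquely_extends_to_coherent_elementary C D M N \<alpha>"
    using that unfolding extends_to_coherent_elementary_def uniquely_extends_to_coherent_elementary_def
    by blast
  then show ?thesis using unique criterion by blast
qed

end
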